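(* Let $\Sigma(x)$ be an $\boldsymbol{e}$-invariant partial type such that $\boldsymbol{e}\in\operatorname{dcl}(c_0)$ for some small tuple $c_0$ of realizations of $\Sigma$. Let $H\le\operatorname{Aut}_{\boldsymbol{e}}(\mathfrak{C})$ be such that $\equiv^H$ is weaker than $\equiv^{\mathrm L}_{\boldsymbol{e}}$ (that is, if $c\equiv^{\mathrm L}_{\boldsymbol{e}} d$, then $c\equiv^H d$). Then $$H^{\mathrm{res}}\operatorname{Autf}_{\mathrm L}(\Sigma,\boldsymbol{e})=\operatorname{Aut}_{\equiv^H}(\Sigma,\boldsymbol{e}),$$ where $H^{\mathrm{res}}\operatorname{Autf}_{\mathrm L}(\Sigma,\boldsymbol{e})=\{g_1g_2\in\operatorname{Aut}_{\boldsymbol{e}}(\Sigma): g_1\in H^{\mathrm{res}},\ g_2\in\operatorname{Autf}_{\mathrm L}(\Sigma,\boldsymbol{e})\}$. Especially, for $X\in\{\mathrm L,\mathrm{KP},\mathrm S\}$, $\operatorname{Autf}^{\mathrm{res}}_X(\Sigma,\boldsymbol{e})\operatorname{Autf}_{\mathrm L}(\Sigma,\boldsymbol{e})=\operatorname{Autf}_X(\Sigma,\boldsymbol{e})$.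
   Context: Setup. $T$ is a complete first-order theory with monster model $\mathfrak{C}$; "small" means of size less than the degree of saturation and strong homogeneity of $\mathfrak{C}$. All sets, tuples, ordinals, cardinals and (elementary sub)models considered are small. A hyperimaginary is an equivalence class $a_E$ of an $\emptyset$-type-definable equivalence relation $E$ on $\mathfrak{C}^\alpha$ ($\alpha$ a small ordinal), with representative $a$. $\boldsymbol{e}=a_E$ is a fixed arbitrary hyperimaginary and $\operatorname{Aut}_{\boldsymbol{e}}(\mathfrak{C})=\{f\in\operatorname{Aut}(\mathfrak{C}): f(\boldsymbol{e})=\boldsymbol{e}\text{ setwise}\}$. For a tuple or set $c$, $\boldsymbol{e}\in\operatorname{dcl}(c)$ means every automorphism fixing $c$ pointwise fixes $\boldsymbol{e}$. Lascar, KP and Shelah strong types. $\operatorname{Autf}_{\mathrm L}(\mathfrak{C},\boldsymbol{e})$ is the (normal) subgroup of $\operatorname{Aut}_{\boldsymbol{e}}(\mathfrak{C})$ generated by those $f\in\operatorname{Aut}_{\boldsymbol{e}}(\mathfrak{C})$ that fix pointwise some model $M\models T$ with $\boldsymbol{e}\in\operatorname{dcl}(M)$. Put $\operatorname{Gal}_{\mathrm L}(T,\boldsymbol{e})=\operatorname{Aut}_{\boldsymbol{e}}(\mathfrak{C})/\operatorname{Autf}_{\mathrm L}(\mathfrak{C},\boldsymbol{e})$ with quotient map $\pi$. Its topology is the quotient topology under the well-defined map $\{\operatorname{tp}(f(M)/M): f\in\operatorname{Aut}_{\boldsymbol{e}}(\mathfrak{C})\}\to\operatorname{Gal}_{\mathrm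 L}(T,\boldsymbol{e})$, $\operatorname{tp}(f(M)/M)\mapsto [f]$, for a small model $M$ with $\boldsymbol{e}\in\operatorname{dcl}(M)$ (the domain has the logic topology; the result is independent of $M$ and is a quasi-compact topological group). $\operatorname{Autf}_{\mathrm{KP}}(\mathfrak{C},\boldsymbol{e})$ is the $\pi$-preimage of the closure of the trivial subgroup, and $\operatorname{Autf}_{\mathrm{S}}(\mathfrak{C},\boldsymbol{e})$ is the $\pi$-preimage of the connected component of the identity. For $X\in\{\mathrm L,\mathrm{KP},\mathrm S\}$, $c\equiv^X_{\boldsymbol{e}} d$ means there is $f\in\operatorname{Autf}_X(\mathfrak{C},\boldsymbol{e})$ with $f(c)=d$. For $H\le\operatorname{Aut}_{\boldsymbol{e}}(\mathfrak{C})$ and tuples $c,d$ in $\mathfrak{C}$, $c\equiv^H d$ means there is $h\in H$ with $h(c)=d$. Relativization and restriction. $\Sigma(x)$ is a partial type, $x$ a possibly infinite tuple of variables; $\boldsymbol{e}$-invariant means that for $f\in\operatorname{Aut}_{\boldsymbol{e}}(\mathfrak{C})$, $b\models\Sigma$ iff $f(b)\models\Sigma$. $\Sigma(\mathfrak{C})$ is its solution set. A tuple of realizations of $\Sigma$ is a tuple $(b_i)_{i<\lambda}$ with each $b_i\models\Sigma$. $\operatorname{Aut}_{\boldsymbol{e}}(\Sigma)=\{f\upharpoonright\Sigma(\mathfrak{C}): f\in\operatorname{Aut}_{\boldsymbol{e}}(\mathfrak{C})\}$. For $X\in\{\mathrm L,\mathrm{KP},\mathrm S\}$, $\operatorname{Autf}_X(\Sigma,\boldsymbol{e})$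 is the normal subgroup of all $\sigma\in\operatorname{Aut}_{\boldsymbol{e}}(\Sigma)$ with $b\equiv^X_{\boldsymbol{e}}\sigma(b)$ for every tuple $b$ (of any length) of realizations of $\Sigma$, and $\operatorname{Autf}^{\mathrm{res}}_X(\Sigma,\boldsymbol{e})=\{f\upharpoonright\Sigma(\mathfrak{C}): f\in\operatorname{Autf}_X(\mathfrak{C},\boldsymbol{e})\}$. For $H\le\operatorname{Aut}_{\boldsymbol{e}}(\mathfrak{C})$: $H^{\mathrm{res}}=\{f\upharpoonright\Sigma(\mathfrak{C}): f\in H\}$ and $\operatorname{Aut}_{\equiv^H}(\Sigma,\boldsymbol{e})=\{\sigma\in\operatorname{Aut}_{\boldsymbol{e}}(\Sigma): c\equiv^H\sigma(c)\text{ for every tuple }c\text{ of realizations of }\Sigma\}$. *)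

theory Defs
  imports "HOL-Analysis.Analysis" "HOL-Algebra.Coset" "HOL-Algebra.Generated_Groups"
begin

unbundle cardinal_syntax

section \<open>First-order logic\<close>

record ('f, 'r) language =
  Funs :: "'f set"
  Rels :: "'r set"
  fun_arity :: "'f \<Rightarrow> nat"
  rel_arity :: "'r \<Rightarrow> nat"

text \<open>Locally nameless syntax: bound variables are de Bruijn indices, free variables are taken
  from an arbitrary type, so that \<open>L\<close>-formulas in variables \<open>x\<^sub>i\<close> with parameters \<open>a\<close> are formulas
  over a sum type, with \<open>FVar (Inl i)\<close> for \<open>x\<^sub>i\<close> and \<open>FVar (Inr a)\<close> for \<open>a\<close>.\<close>

datatype ('f, tm_vars: 'v) tm =
  BVar nat
| FVar 'v
| App 'f "('f, 'v) tm list"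

datatype ('f, 'r, fm_vars: 'v) fm =
  Falsum
| Equal "('f, 'v) tm" "('f, 'v) tm"
| Pred 'r "('f, 'v) tm list"
| Implies "('f, 'r, 'v) fm" "('f, 'r, 'v) fm"
| Forall "('f, 'r, 'v) fm"

abbreviation Neg :: "('f, 'r, 'v) fm \<Rightarrow> ('f, 'r, 'v) fm" where
  "Neg \<phi> \<equiv> Implies \<phi> Falsum"

fun wf_tm :: "('f, 'r) language \<Rightarrow> nat \<Rightarrow> ('f, 'v) tm \<Rightarrow> bool" where
  "wf_tm L n (BVar k) \<longleftrightarrow> k < n"
| "wf_tm L n (FVar v) \<longleftrightarrow> True"
| "wf_tm L n (App F ts) \<longleftrightarrow>
    F \<in> Funs L \<and> length ts = fun_arity L F \<and> (\<forall>t\<in>set ts. wf_tm L n t)"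

fun wf_fm :: "('f, 'r) language \<Rightarrow> nat \<Rightarrow> ('f, 'r, 'v) fm \<Rightarrow> bool" where
  "wf_fm L n Falsum \<longleftrightarrow> True"
| "wf_fm L n (Equal s t) \<longleftrightarrow> wf_tm L n s \<and> wf_tm L n t"
| "wf_fm L n (Pred R ts) \<longleftrightarrow>
    R \<in> Rels L \<and> length ts = rel_arity L R \<and> (\<forall>t\<in>set ts. wf_tm L n t)"
| "wf_fm L n (Implies \<phi> \<psi>) \<longleftrightarrow> wf_fm L n \<phi> \<and> wf_fm L n \<psi>"
| "wf_fm L n (Forall \<phi>) \<longleftrightarrow> wf_fm L (Suc n) \<phi>"

definition formulas :: "('f, 'r) language \<Rightarrow> 'v set \<Rightarrow> ('f, 'r, 'v) fm set" where
  "formulas L V = {\<phi>. wf_fm L 0 \<phi> \<and> fm_vars \<phi> \<subseteq> V}"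

record ('f, 'r, 'm) struct =
  univ :: "'m set"
  fun_int :: "'f \<Rightarrow> 'm list \<Rightarrow> 'm"
  rel_int :: "'r \<Rightarrow> 'm list \<Rightarrow> bool"

definition is_structure :: "('f, 'r) language \<Rightarrow> ('f, 'r, 'm) struct \<Rightarrow> bool" where
  "is_structure L S \<longleftrightarrow> univ S \<noteq> {} \<and>
    (\<forall>F\<in>Funs L. \<forall>xs\<in>lists (univ S). length xs = fun_arity L F \<longrightarrow> fun_int S F xs \<in> univ S)"

fun eval_tm :: "('f, 'r, 'm) struct \<Rightarrow> 'm list \<Rightarrow> ('v \<Rightarrow> 'm) \<Rightarrow> ('f, 'v) tm \<Rightarrow> 'm" where
  "eval_tm S xs \<rho> (BVar k) = xs ! k"
| "eval_tm S xs \<rho> (FVar v) = \<rho> v"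
| "eval_tm S xs \<rho> (App F ts) = fun_int S F (map (eval_tm S xs \<rho>) ts)"

fun eval_fm :: "('f, 'r, 'm) struct \<Rightarrow> 'm list \<Rightarrow> ('v \<Rightarrow> 'm) \<Rightarrow> ('f, 'r, 'v) fm \<Rightarrow> bool" where
  "eval_fm S xs \<rho> Falsum \<longleftrightarrow> False"
| "eval_fm S xs \<rho> (Equal s t) \<longleftrightarrow> eval_tm S xs \<rho> s = eval_tm S xs \<rho> t"
| "eval_fm S xs \<rho> (Pred R ts) \<longleftrightarrow> rel_int S R (map (eval_tm S xs \<rho>) ts)"
| "eval_fm S xs \<rho> (Implies \<phi> \<psi>) \<longleftrightarrow> (eval_fm S xs \<rho> \<phi> \<longrightarrow> eval_fm S xs \<rho> \<psi>)"
| "eval_fm S xs \<rho> (Forall \<phi>) \<longleftrightarrow> (\<forall>x\<in>univ S. eval_fm S (x # xs) \<rho> \<phi>)"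

definition satisfies :: "('f, 'r, 'm) struct \<Rightarrow> ('v \<Rightarrow> 'm) \<Rightarrow> ('f, 'r, 'v) fm \<Rightarrow> bool" where
  "satisfies S \<rho> \<phi> \<longleftrightarrow> eval_fm S [] \<rho> \<phi>"

text \<open>A complete theory is identified with its deductive closure, a maximal consistent set of
  sentences; consistency comes from having a model.\<close>

definition complete_theory :: "('f, 'r) language \<Rightarrow> ('f, 'r, nat) fm set \<Rightarrow> bool" where
  "complete_theory L T \<longleftrightarrow> T \<subseteq> formulas L {} \<and>
    (\<forall>\<phi>\<in>formulas L {}. (\<phi> \<in> T) \<noteq> (Neg \<phi> \<in> T))"

definition models :: "('f, 'r) language \<Rightarrow> ('f, 'r, 'm) struct \<Rightarrow> ('f, 'r, nat) fm set \<Rightarrow> bool" where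
  "models L S T \<longleftrightarrow> is_structure L S \<and> (\<forall>\<phi>\<in>T. \<forall>\<rho>. satisfies S \<rho> \<phi>)"


section \<open>The monster model\<close>

text \<open>The monster model has universe \<open>UNIV\<close> of an arbitrary type. Its degree of saturation and
  strong homogeneity is a cardinal \<open>\<kappa>\<close>, given as a cardinal order. The ordinals below \<open>\<kappa>\<close> are the
  elements \<open>\<alpha> \<in> Field \<kappa>\<close>, with \<open>underS \<kappa> \<alpha>\<close> as underlying set, and tuples of length \<open>\<alpha>\<close> are
  (extensional) functions on \<open>underS \<kappa> \<alpha>\<close>.\<close>

definition is_aut :: "('f, 'r) language \<Rightarrow> ('f, 'r, 'm) struct \<Rightarrow> ('m \<Rightarrow> 'm) \<Rightarrow> bool" where
  "is_aut L C f \<longleftrightarrow> bij f \<and>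
    (\<forall>F\<in>Funs L. \<forall>xs. length xs = fun_arity L F \<longrightarrow> f (fun_int C F xs) = fun_int C F (map f xs)) \<and>
    (\<forall>R\<in>Rels L. \<forall>xs. length xs = rel_arity L R \<longrightarrow> rel_int C R (map f xs) = rel_int C R xs)"

definition saturated :: "'k rel \<Rightarrow> ('f, 'r) language \<Rightarrow> ('f, 'r, 'm) struct \<Rightarrow> bool" where
  "saturated \<kappa> L C \<longleftrightarrow>
    (\<forall>A p. |A| <o \<kappa> \<longrightarrow> p \<subseteq> formulas L ({()} <+> A) \<longrightarrow>
      (\<forall>q. finite q \<and> q \<subseteq> p \<longrightarrow> (\<exists>c. \<forall>\<phi>\<in>q. satisfies C (case_sum (\<lambda>_. c) id) \<phi>)) \<longrightarrow>
      (\<exists>c. \<forall>\<phi>\<in>p. satisfies C (case_sum (\<lambda>_. c) id) \<phi>))"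

definition strongly_homogeneous :: "'k rel \<Rightarrow> ('f, 'r) language \<Rightarrow> ('f, 'r, 'm) struct \<Rightarrow> bool" where
  "strongly_homogeneous \<kappa> L C \<longleftrightarrow>
    (\<forall>A g. |A| <o \<kappa> \<longrightarrow>
      (\<forall>\<phi>\<in>formulas L A. satisfies C g \<phi> \<longleftrightarrow> satisfies C id \<phi>) \<longrightarrow>
      (\<exists>f. is_aut L C f \<and> (\<forall>a\<in>A. f a = g a)))"

text \<open>The only largeness requirement imposed on \<open>\<kappa>\<close> is that it exceeds \<open>|T| = |L| + \<aleph>\<^sub>0\<close>.\<close>

definition monster_model ::
  "'k rel \<Rightarrow> ('f, 'r) language \<Rightarrow> ('f, 'r, nat) fm set \<Rightarrow> ('f, 'r, 'm) struct \<Rightarrow> bool" where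
  "monster_model \<kappa> L T C \<longleftrightarrow>
    Card_order \<kappa> \<and> natLeq <o \<kappa> \<and> |Funs L <+> Rels L| <o \<kappa> \<and>
    univ C = UNIV \<and> models L C T \<and> saturated \<kappa> L C \<and> strongly_homogeneous \<kappa> L C"

definition small_model ::
  "'k rel \<Rightarrow> ('f, 'r) language \<Rightarrow> ('f, 'r, 'm) struct \<Rightarrow> 'm set \<Rightarrow> bool" where
  "small_model \<kappa> L C M \<longleftrightarrow> |M| <o \<kappa> \<and> is_structure L (C\<lparr>univ := M\<rparr>) \<and>
    (\<forall>\<phi>\<in>formulas L M. satisfies (C\<lparr>univ := M\<rparr>) id \<phi> \<longleftrightarrow> satisfies C id \<phi>)"

abbreviation tuples :: "'k set \<Rightarrow> 'm set \<Rightarrow> ('k \<Rightarrow> 'm) set" where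
  "tuples I A \<equiv> I \<rightarrow>\<^sub>E A"


section \<open>Hyperimaginaries\<close>

text \<open>Throughout, a hyperimaginary is an equivalence class \<open>e\<close> of tuples indexed by \<open>I\<close>.
  Since \<open>compose I f a = (\<lambda>i\<in>I. f (a i))\<close>, \<open>compose I f\<close> is the action of \<open>f\<close> on such tuples.\<close>

definition type_definable_rel ::
  "('f, 'r) language \<Rightarrow> ('f, 'r, 'm) struct \<Rightarrow> 'k set \<Rightarrow> ('k \<Rightarrow> 'm) rel \<Rightarrow> bool" where
  "type_definable_rel L C I E \<longleftrightarrow>
    (\<exists>\<Phi> \<subseteq> formulas L (I <+> I).
      E = {(a, b) \<in> tuples I UNIV \<times> tuples I UNIV. \<forall>\<phi>\<in>\<Phi>. satisfies C (case_sum a b) \<phi>})"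

definition hyperimaginary ::
  "('f, 'r) language \<Rightarrow> ('f, 'r, 'm) struct \<Rightarrow> 'k set \<Rightarrow> ('k \<Rightarrow> 'm) set \<Rightarrow> bool" where
  "hyperimaginary L C I e \<longleftrightarrow>
    (\<exists>E. equiv (tuples I UNIV) E \<and> type_definable_rel L C I E \<and> e \<in> tuples I UNIV // E)"

definition fixes_hyp :: "'k set \<Rightarrow> ('k \<Rightarrow> 'm) set \<Rightarrow> ('m \<Rightarrow> 'm) \<Rightarrow> bool" where
  "fixes_hyp I e f \<longleftrightarrow> compose I f ` e = e"

definition hyp_in_dcl ::
  "('f, 'r) language \<Rightarrow> ('f, 'r, 'm) struct \<Rightarrow> 'k set \<Rightarrow> ('k \<Rightarrow> 'm) set \<Rightarrow> 'm set \<Rightarrow> bool" where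
  "hyp_in_dcl L C I e A \<longleftrightarrow> (\<forall>f. is_aut L C f \<and> (\<forall>a\<in>A. f a = a) \<longrightarrow> fixes_hyp I e f)"

definition Aut_hyp ::
  "('f, 'r) language \<Rightarrow> ('f, 'r, 'm) struct \<Rightarrow> 'k set \<Rightarrow> ('k \<Rightarrow> 'm) set \<Rightarrow> ('m \<Rightarrow> 'm) monoid" where
  "Aut_hyp L C I e =
    \<lparr>carrier = {f. is_aut L C f \<and> fixes_hyp I e f}, mult = (\<circ>), one = id\<rparr>"


section \<open>Lascar, KP and Shelah strong types\<close>

definition Autf_L ::
  "'k rel \<Rightarrow> ('f, 'r) language \<Rightarrow> ('f, 'r, 'm) struct \<Rightarrow> 'k set \<Rightarrow> ('k \<Rightarrow> 'm) set \<Rightarrow>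
    ('m \<Rightarrow> 'm) set" where
  "Autf_L \<kappa> L C I e = generate (Aut_hyp L C I e)
    {f \<in> carrier (Aut_hyp L C I e).
      \<exists>M. small_model \<kappa> L C M \<and> hyp_in_dcl L C I e M \<and> (\<forall>m\<in>M. f m = m)}"

definition Gal_L ::
  "'k rel \<Rightarrow> ('f, 'r) language \<Rightarrow> ('f, 'r, 'm) struct \<Rightarrow> 'k set \<Rightarrow> ('k \<Rightarrow> 'm) set \<Rightarrow>
    ('m \<Rightarrow> 'm) set monoid" where
  "Gal_L \<kappa> L C I e = Aut_hyp L C I e Mod Autf_L \<kappa> L C I e"

definition Gal_proj ::
  "'k rel \<Rightarrow> ('f, 'r) language \<Rightarrow> ('f, 'r, 'm) struct \<Rightarrow> 'k set \<Rightarrow> ('k \<Rightarrow> 'm) set \<Rightarrow>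
    ('m \<Rightarrow> 'm) \<Rightarrow> ('m \<Rightarrow> 'm) set" where
  "Gal_proj \<kappa> L C I e f = Autf_L \<kappa> L C I e #>\<^bsub>Aut_hyp L C I e\<^esub> f"

text \<open>\<open>tp (f(M) / M)\<close>, where \<open>M\<close> is enumerated by itself: \<open>Inl m\<close> is the variable of the type
  corresponding to \<open>m\<close>, realized by \<open>f m\<close>, and \<open>Inr m\<close> is the parameter \<open>m\<close>.\<close>

definition tp_image ::
  "('f, 'r) language \<Rightarrow> ('f, 'r, 'm) struct \<Rightarrow> 'm set \<Rightarrow> ('m \<Rightarrow> 'm) \<Rightarrow> ('f, 'r, 'm + 'm) fm set" where
  "tp_image L C M f = {\<phi> \<in> formulas L (M <+> M). satisfies C (case_sum f id) \<phi>}"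

definition type_space ::
  "('f, 'r) language \<Rightarrow> ('f, 'r, 'm) struct \<Rightarrow> 'k set \<Rightarrow> ('k \<Rightarrow> 'm) set \<Rightarrow> 'm set \<Rightarrow>
    ('f, 'r, 'm + 'm) fm set topology" where
  "type_space L C I e M = topology_generated_by
    {{p \<in> tp_image L C M ` carrier (Aut_hyp L C I e). \<phi> \<in> p} | \<phi>. \<phi> \<in> formulas L (M <+> M)}"

text \<open>The map \<open>tp (f(M) / M) \<mapsto> [f]\<close>.\<close>

definition type_to_Gal ::
  "'k rel \<Rightarrow> ('f, 'r) language \<Rightarrow> ('f, 'r, 'm) struct \<Rightarrow> 'k set \<Rightarrow> ('k \<Rightarrow> 'm) set \<Rightarrow> 'm set \<Rightarrow>
    ('f, 'r, 'm + 'm) fm set \<Rightarrow> ('m \<Rightarrow> 'm) set" where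
  "type_to_Gal \<kappa> L C I e M p =
    Gal_proj \<kappa> L C I e (SOME f. f \<in> carrier (Aut_hyp L C I e) \<and> tp_image L C M f = p)"

definition Gal_topology ::
  "'k rel \<Rightarrow> ('f, 'r) language \<Rightarrow> ('f, 'r, 'm) struct \<Rightarrow> 'k set \<Rightarrow> ('k \<Rightarrow> 'm) set \<Rightarrow> 'm set \<Rightarrow>
    ('m \<Rightarrow> 'm) set topology" where
  "Gal_topology \<kappa> L C I e M = topology (\<lambda>U. U \<subseteq> carrier (Gal_L \<kappa> L C I e) \<and>
    openin (type_space L C I e M)
      {p \<in> topspace (type_space L C I e M). type_to_Gal \<kappa> L C I e M p \<in> U})"

lemma openin_Gal_topology:
  "openin (Gal_topology \<kappa> L C I e M) U \<longleftrightarrow> U \<subseteq> carrier (Gal_L \<kappa> L C I e) \<and>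
    openin (type_space L C I e M)
      {p \<in> topspace (type_space L C I e M). type_to_Gal \<kappa> L C I e M p \<in> U}"
proof -
  let ?X = "type_space L C I e M" and ?v = "type_to_Gal \<kappa> L C I e M"
  have "istopology (\<lambda>U. U \<subseteq> carrier (Gal_L \<kappa> L C I e) \<and> openin ?X {p \<in> topspace ?X. ?v p \<in> U})"
    unfolding istopology_def
  proof (intro conjI allI impI)
    fix S T
    assume S: "S \<subseteq> carrier (Gal_L \<kappa> L C I e) \<and> openin ?X {p \<in> topspace ?X. ?v p \<in> S}"
      and T: "T \<subseteq> carrier (Gal_L \<kappa> L C I e) \<and> openin ?X {p \<in> topspace ?X. ?v p \<in> T}"
    have "{p \<in> topspace ?X. ?v p \<in> S \<inter> T}
        = {p \<in> topspace ?X. ?v p \<in> S} \<inter> {p \<in> topspace ?X. ?v p \<in> T}" by auto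
    then show "openin ?X {p \<in> topspace ?X. ?v p \<in> S \<inter> T}" using S T by auto
    show "S \<inter> T \<subseteq> carrier (Gal_L \<kappa> L C I e)" using S by auto
  next
    fix K
    assume K: "\<forall>S\<in>K. S \<subseteq> carrier (Gal_L \<kappa> L C I e) \<and> openin ?X {p \<in> topspace ?X. ?v p \<in> S}"
    have "{p \<in> topspace ?X. ?v p \<in> \<Union>K} = (\<Union>S\<in>K. {p \<in> topspace ?X. ?v p \<in> S})" by auto
    then show "openin ?X {p \<in> topspace ?X. ?v p \<in> \<Union>K}" using K by auto
    show "\<Union>K \<subseteq> carrier (Gal_L \<kappa> L C I e)" using K by auto
  qed
  then show ?thesis unfolding Gal_topology_def by (simp add: topology_inverse')
qed

datatype strong_type = Lascar | KP | Shelah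

text \<open>The model \<open>M\<close> is the one used to define the topology of \<open>Gal_L\<close>; it plays no role for
  \<open>Lascar\<close>.\<close>

fun Autf ::
  "'k rel \<Rightarrow> ('f, 'r) language \<Rightarrow> ('f, 'r, 'm) struct \<Rightarrow> 'k set \<Rightarrow> ('k \<Rightarrow> 'm) set \<Rightarrow> 'm set \<Rightarrow>
    strong_type \<Rightarrow> ('m \<Rightarrow> 'm) set" where
  "Autf \<kappa> L C I e M Lascar = Autf_L \<kappa> L C I e"
| "Autf \<kappa> L C I e M KP = {f \<in> carrier (Aut_hyp L C I e). Gal_proj \<kappa> L C I e f \<in>
    Gal_topology \<kappa> L C I e M closure_of {\<one>\<^bsub>Gal_L \<kappa> L C I e\<^esub>}}"
| "Autf \<kappa> L C I e M Shelah = {f \<in> carrier (Aut_hyp L C I e). Gal_proj \<kappa> L C I e f \<in>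
    connected_component_of_set (Gal_topology \<kappa> L C I e M) \<one>\<^bsub>Gal_L \<kappa> L C I e\<^esub>}"

text \<open>\<open>c \<equiv>\<^sup>H d\<close> for tuples indexed by \<open>I\<close>.\<close>

definition orbit_equiv :: "('m \<Rightarrow> 'm) set \<Rightarrow> 'i set \<Rightarrow> ('i \<Rightarrow> 'm) \<Rightarrow> ('i \<Rightarrow> 'm) \<Rightarrow> bool" where
  "orbit_equiv H I c d \<longleftrightarrow> (\<exists>h\<in>H. \<forall>i\<in>I. h (c i) = d i)"

text \<open>Every \<open>\<equiv>\<^sup>K\<close>-equivalent pair of small tuples is \<open>\<equiv>\<^sup>H\<close>-equivalent.\<close>

definition weaker_equiv :: "'k rel \<Rightarrow> ('m \<Rightarrow> 'm) set \<Rightarrow> ('m \<Rightarrow> 'm) set \<Rightarrow> bool" where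
  "weaker_equiv \<kappa> H K \<longleftrightarrow> (\<forall>l\<in>Field \<kappa>. \<forall>c d.
    orbit_equiv K (underS \<kappa> l) c d \<longrightarrow> orbit_equiv H (underS \<kappa> l) c d)"


section \<open>Relativization to a partial type\<close>

definition solutions :: "('f, 'r, 'm) struct \<Rightarrow> 'k set \<Rightarrow> ('f, 'r, 'k + 'm) fm set \<Rightarrow>
    ('k \<Rightarrow> 'm) set" where
  "solutions C J \<Sigma> = {b \<in> tuples J UNIV. \<forall>\<phi>\<in>\<Sigma>. satisfies C (case_sum b id) \<phi>}"

definition partial_type :: "'k rel \<Rightarrow> ('f, 'r) language \<Rightarrow> ('f, 'r, 'm) struct \<Rightarrow> 'k set \<Rightarrow>
    ('f, 'r, 'k + 'm) fm set \<Rightarrow> bool" where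
  "partial_type \<kappa> L C J \<Sigma> \<longleftrightarrow> (\<exists>A. |A| <o \<kappa> \<and> \<Sigma> \<subseteq> formulas L (J <+> A)) \<and>
    (\<forall>\<Sigma>'. finite \<Sigma>' \<and> \<Sigma>' \<subseteq> \<Sigma> \<longrightarrow> solutions C J \<Sigma>' \<noteq> {})"

definition hyp_invariant :: "('f, 'r) language \<Rightarrow> ('f, 'r, 'm) struct \<Rightarrow> 'k set \<Rightarrow>
    ('k \<Rightarrow> 'm) set \<Rightarrow> 'k set \<Rightarrow> ('f, 'r, 'k + 'm) fm set \<Rightarrow> bool" where
  "hyp_invariant L C I e J \<Sigma> \<longleftrightarrow>
    (\<forall>f\<in>carrier (Aut_hyp L C I e). \<forall>b\<in>tuples J UNIV.
      b \<in> solutions C J \<Sigma> \<longleftrightarrow> compose J f b \<in> solutions C J \<Sigma>)"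

text \<open>In the remaining definitions \<open>S\<close> is the solution set of a partial type whose variables are
  indexed by \<open>J\<close>.\<close>

definition restr :: "'k set \<Rightarrow> ('k \<Rightarrow> 'm) set \<Rightarrow> ('m \<Rightarrow> 'm) \<Rightarrow> ('k \<Rightarrow> 'm) \<Rightarrow> ('k \<Rightarrow> 'm)" where
  "restr J S f = restrict (compose J f) S"

definition Aut_type :: "('f, 'r) language \<Rightarrow> ('f, 'r, 'm) struct \<Rightarrow> 'k set \<Rightarrow>
    ('k \<Rightarrow> 'm) set \<Rightarrow> 'k set \<Rightarrow> ('k \<Rightarrow> 'm) set \<Rightarrow> (('k \<Rightarrow> 'm) \<Rightarrow> ('k \<Rightarrow> 'm)) monoid" where
  "Aut_type L C I e J S =
    \<lparr>carrier = restr J S ` carrier (Aut_hyp L C I e), mult = compose S, one = restrict id S\<rparr>"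

text \<open>A small tuple \<open>(c\<^sub>i)\<close>, \<open>i < l\<close>, of realizations is viewed as the tuple of all its
  coordinates, indexed by the pairs \<open>(i, j)\<close> with \<open>j \<in> J\<close>.\<close>

definition Aut_type_equiv :: "'k rel \<Rightarrow> ('f, 'r) language \<Rightarrow> ('f, 'r, 'm) struct \<Rightarrow> 'k set \<Rightarrow>
    ('k \<Rightarrow> 'm) set \<Rightarrow> 'k set \<Rightarrow> ('k \<Rightarrow> 'm) set \<Rightarrow> ('m \<Rightarrow> 'm) set \<Rightarrow>
    (('k \<Rightarrow> 'm) \<Rightarrow> ('k \<Rightarrow> 'm)) set" where
  "Aut_type_equiv \<kappa> L C I e J S H =
    {\<sigma> \<in> carrier (Aut_type L C I e J S). \<forall>l\<in>Field \<kappa>. \<forall>c\<in>underS \<kappa> l \<rightarrow>\<^sub>E S.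
      orbit_equiv H (underS \<kappa> l \<times> J) (\<lambda>(i, j). c i j) (\<lambda>(i, j). \<sigma> (c i) j)}"

definition Autf_type :: "'k rel \<Rightarrow> ('f, 'r) language \<Rightarrow> ('f, 'r, 'm) struct \<Rightarrow> 'k set \<Rightarrow>
    ('k \<Rightarrow> 'm) set \<Rightarrow> 'k set \<Rightarrow> ('k \<Rightarrow> 'm) set \<Rightarrow> 'm set \<Rightarrow> strong_type \<Rightarrow>
    (('k \<Rightarrow> 'm) \<Rightarrow> ('k \<Rightarrow> 'm)) set" where
  "Autf_type \<kappa> L C I e J S M X = Aut_type_equiv \<kappa> L C I e J S (Autf \<kappa> L C I e M X)"

end

theory Submission
  imports Defs
begin

text \<open>
  One inclusion is formal: if \<open>h \<in> H\<close> and \<open>g\<close> preserves Lascar strong types of tuples of realizations,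
  then \<open>c \<equiv>\<^sup>L g(c)\<close> gives \<open>c \<equiv>\<^sup>H g(c)\<close> and hence \<open>c \<equiv>\<^sup>H h(g(c))\<close>.

  For the other one, the point is to find a small set \<open>B\<close> of realizations of \<open>\<Sigma>\<close> such that every
  automorphism fixing all coordinates of \<open>B\<close> maps each small tuple of realizations to one with the
  same Lascar strong type.  Given \<open>f\<close> with \<open>c \<equiv>\<^sup>H f(c)\<close> for all small tuples \<open>c\<close>, apply this to an
  enumeration of \<open>B\<close>: some \<open>h \<in> H\<close> agrees with \<open>f\<close> on \<open>B\<close>, so the restriction of \<open>h\<^sup>-\<^sup>1 f\<close> preserves
  Lascar strong types and \<open>f = h (h\<^sup>-\<^sup>1 f)\<close> is the required product (\<open>restr_product_eq\<close>).

  The set \<open>B\<close> contains the tuple \<open>c0\<close>, so that \<open>e\<close> is definable over it, and is closed under witnesses: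
  a formula over \<open>B\<close> that is satisfied by realizations of \<open>\<Sigma>\<close> is satisfied by members of \<open>B\<close>
  (\<open>exists_relatively_closed\<close>, a relative form of the downward Loewenheim--Skolem theorem).
  Consequently the type over \<open>B\<close> of any tuple \<open>c\<close> of realizations is finitely satisfiable in \<open>B\<close> and
  extends to a global type \<open>P\<close> with this property (\<open>exists_coheir\<close>), which is invariant over \<open>B\<close>
  (\<open>coheir_invariant\<close>).  Suppose \<open>u\<close> realizes \<open>P\<close> over \<open>B\<close> and \<open>d\<close> realizes \<open>P\<close> over \<open>B\<close> and \<open>u\<close>.
  By invariance the type of \<open>(u, d)\<close> over \<open>B\<close> is determined by \<open>P\<close>, and it is also the type of a pair
  \<open>(d1, d2)\<close> that is conjugate over a small model containing \<open>B\<close>.  By homogeneity \<open>u\<close> and \<open>d\<close> are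
  conjugate over such a model (\<open>coheir_realizations_conjugate_over_model\<close>).  If an automorphism \<open>f\<close>
  fixes \<open>B\<close>, then \<open>c\<close> and \<open>f(c)\<close> both realize \<open>P\<close> over \<open>B\<close>, and they are linked through a common
  \<open>d\<close> (\<open>aut_over_relatively_closed_orbit_equiv\<close>).

  The statement for the Lascar, KP and Shelah groups follows by the same argument, because each of
  them is a union of cosets of the normal Lascar group (\<open>Autf_comp_Lascar\<close>).

  The tuples involved are infinite, so saturation and homogeneity are first extended from single
  variables and sets to small tuples (\<open>realize_type\<close>, \<open>homogeneous_tuples\<close>).
\<close>

section \<open>Substitution for free and dangling variables\<close>

fun place :: "nat \<Rightarrow> nat + 'w \<Rightarrow> ('f, 'w) tm" where
  "place d (Inl i) = BVar (d + i)"
| "place d (Inr w) = FVar w"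

text \<open>Below \<open>d\<close> binders, the dangling bound variables are those with index at least \<open>d\<close>.  Both
  dangling and free variables are replaced simultaneously, each by a dangling or a free variable;
  renaming, abstraction and instantiation of a variable are all of this form.\<close>

fun rebind_tm :: "(nat \<Rightarrow> nat + 'w) \<Rightarrow> ('v \<Rightarrow> nat + 'w) \<Rightarrow> nat \<Rightarrow> ('f, 'v) tm \<Rightarrow> ('f, 'w) tm" where
  "rebind_tm b g d (BVar k) = (if k < d then BVar k else place d (b (k - d)))"
| "rebind_tm b g d (FVar v) = place d (g v)"
| "rebind_tm b g d (App F ts) = App F (map (rebind_tm b g d) ts)"

fun rebind_fm ::
  "(nat \<Rightarrow> nat + 'w) \<Rightarrow> ('v \<Rightarrow> nat + 'w) \<Rightarrow> nat \<Rightarrow> ('f, 'r, 'v) fm \<Rightarrow> ('f, 'r, 'w) fm" where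
  "rebind_fm b g d Falsum = Falsum"
| "rebind_fm b g d (Equal s t) = Equal (rebind_tm b g d s) (rebind_tm b g d t)"
| "rebind_fm b g d (Pred R ts) = Pred R (map (rebind_tm b g d) ts)"
| "rebind_fm b g d (Implies \<phi> \<psi>) = Implies (rebind_fm b g d \<phi>) (rebind_fm b g d \<psi>)"
| "rebind_fm b g d (Forall \<phi>) = Forall (rebind_fm b g (Suc d) \<phi>)"

lemma wf_rebind_tm:
  assumes "wf_tm L (d + n) t" "\<And>k i. k < n \<Longrightarrow> b k = Inl i \<Longrightarrow> i < m"
    "\<And>v i. v \<in> tm_vars t \<Longrightarrow> g v = Inl i \<Longrightarrow> i < m"
  shows "wf_tm L (d + m) (rebind_tm b g d t)"
  using assms
proof (induction t)
  case (BVar k)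
  then have "k < d \<or> k - d < n" by auto
  then show ?case using BVar by (cases "b (k - d)") auto
next
  case (FVar v)
  then show ?case by (cases "g v") auto
next
  case (App F ts)
  then show ?case by fastforce
qed

lemma wf_rebind_fm:
  assumes "wf_fm L (d + n) \<phi>" "\<And>k i. k < n \<Longrightarrow> b k = Inl i \<Longrightarrow> i < m"
    "\<And>v i. v \<in> fm_vars \<phi> \<Longrightarrow> g v = Inl i \<Longrightarrow> i < m"
  shows "wf_fm L (d + m) (rebind_fm b g d \<phi>)"
  using assms
proof (induction \<phi> arbitrary: d)
  case (Equal s t)
  then show ?case by (auto intro!: wf_rebind_tm)
next
  case (Pred R ts)
  then show ?case by (auto intro!: wf_rebind_tm) blast
next
  case (Implies \<phi> \<psi>)
  then show ?case by fastforce
next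
  case (Forall \<phi>)
  then show ?case using Forall.IH[of "Suc d"] by auto
qed auto

lemma vars_rebind_tm:
  assumes "wf_tm L (d + n) t"
  shows "tm_vars (rebind_tm b g d t) \<subseteq>
    {w. (\<exists>k<n. b k = Inr w) \<or> (\<exists>v\<in>tm_vars t. g v = Inr w)}"
  using assms
proof (induction t)
  case (BVar k)
  then show ?case by (cases "b (k - d)") (auto intro!: exI[of _ "k - d"])
next
  case (FVar v)
  then show ?case by (cases "g v") auto
next
  case (App F ts)
  then show ?case by fastforce
qed

lemma vars_rebind_fm:
  assumes "wf_fm L (d + n) \<phi>"
  shows "fm_vars (rebind_fm b g d \<phi>) \<subseteq>
    {w. (\<exists>k<n. b k = Inr w) \<or> (\<exists>v\<in>fm_vars \<phi>. g v = Inr w)}"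
  using assms
proof (induction \<phi> arbitrary: d)
  case (Equal s t)
  then show ?case using vars_rebind_tm[of L d n] by fastforce
next
  case (Pred R ts)
  then show ?case using vars_rebind_tm[of L d n] by fastforce
next
  case (Implies \<phi> \<psi>)
  then show ?case by fastforce
next
  case (Forall \<phi>)
  then show ?case using Forall.IH[of "Suc d"] by auto
qed auto

lemma eval_rebind_tm:
  assumes "wf_tm L (length zs + length xs) t"
    "\<And>k. k < length xs \<Longrightarrow> case_sum (nth ys) \<rho>' (b k) = xs ! k"
    "\<And>v. v \<in> tm_vars t \<Longrightarrow> case_sum (nth ys) \<rho>' (g v) = \<rho> v"
  shows "eval_tm S (zs @ ys) \<rho>' (rebind_tm b g (length zs) t) = eval_tm S (zs @ xs) \<rho> t"
  using assms
proof (induction t)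
  case (BVar k)
  then show ?case
    using BVar(2)[of "k - length zs"] by (cases "b (k - length zs)") (auto simp: nth_append)
next
  case (FVar v)
  then show ?case by (cases "g v") (auto simp: nth_append)
next
  case (App F ts)
  have "map (eval_tm S (zs @ ys) \<rho>') (map (rebind_tm b g (length zs)) ts)
      = map (eval_tm S (zs @ xs) \<rho>) ts"
    using App by auto
  then show ?case by (simp only: rebind_tm.simps eval_tm.simps)
qed

lemma eval_rebind_fm:
  assumes "wf_fm L (length zs + length xs) \<phi>"
    "\<And>k. k < length xs \<Longrightarrow> case_sum (nth ys) \<rho>' (b k) = xs ! k"
    "\<And>v. v \<in> fm_vars \<phi> \<Longrightarrow> case_sum (nth ys) \<rho>' (g v) = \<rho> v"
  shows "eval_fm S (zs @ ys) \<rho>' (rebind_fm b g (length zs) \<phi>) = eval_fm S (zs @ xs) \<rho> \<phi>"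
  using assms
proof (induction \<phi> arbitrary: zs)
  case (Equal s t)
  then show ?case by (simp add: eval_rebind_tm[where xs = xs and \<rho> = \<rho> and L = L])
next
  case (Pred R ts)
  have "map (eval_tm S (zs @ ys) \<rho>') (map (rebind_tm b g (length zs)) ts)
      = map (eval_tm S (zs @ xs) \<rho>) ts"
    using Pred by (auto intro!: eval_rebind_tm[where L = L])
  then show ?case by (simp only: rebind_fm.simps eval_fm.simps)
next
  case (Forall \<phi>)
  then show ?case using Forall.IH[of "_ # zs"] by auto
qed auto


section \<open>Formulas with variables in a given set\<close>

lemma finite_fm_vars: "finite (fm_vars \<phi>)"
proof -
  have tm: "finite (tm_vars t)" for t :: "('f, 'v) tm"
    by (induction t) auto
  show ?thesis by (induction \<phi>) (auto simp: tm)
qed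

lemma eval_tm_cong:
  "(\<And>v. v \<in> tm_vars t \<Longrightarrow> \<rho> v = \<rho>' v) \<Longrightarrow> eval_tm S xs \<rho> t = eval_tm S xs \<rho>' t"
proof (induction t)
  case (App F ts)
  then have "map (eval_tm S xs \<rho>) ts = map (eval_tm S xs \<rho>') ts" by auto
  then show ?case by (simp only: eval_tm.simps)
qed auto

lemma eval_fm_cong:
  "(\<And>v. v \<in> fm_vars \<phi> \<Longrightarrow> \<rho> v = \<rho>' v) \<Longrightarrow> eval_fm S xs \<rho> \<phi> = eval_fm S xs \<rho>' \<phi>"
proof (induction \<phi> arbitrary: xs)
  case (Equal s t)
  then have "eval_tm S xs \<rho> s = eval_tm S xs \<rho>' s" "eval_tm S xs \<rho> t = eval_tm S xs \<rho>' t"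
    by (auto intro!: eval_tm_cong)
  then show ?case by simp
next
  case (Pred R ts)
  then have "map (eval_tm S xs \<rho>) ts = map (eval_tm S xs \<rho>') ts"
    by (auto intro!: eval_tm_cong)
  then show ?case by (simp only: eval_fm.simps)
qed auto

lemma satisfies_cong:
  "(\<And>v. v \<in> fm_vars \<phi> \<Longrightarrow> \<rho> v = \<rho>' v) \<Longrightarrow> satisfies S \<rho> \<phi> = satisfies S \<rho>' \<phi>"
  unfolding satisfies_def by (rule eval_fm_cong)

lemma satisfies_cong_on:
  "\<phi> \<in> formulas L V \<Longrightarrow> (\<And>v. v \<in> V \<Longrightarrow> \<rho> v = \<rho>' v) \<Longrightarrow> satisfies S \<rho> \<phi> = satisfies S \<rho>' \<phi>"
  by (rule satisfies_cong) (auto simp: formulas_def)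

lemma satisfies_Neg [simp]: "satisfies S \<rho> (Neg \<phi>) \<longleftrightarrow> \<not> satisfies S \<rho> \<phi>"
  by (simp add: satisfies_def)

lemma Neg_in_formulas [simp]: "Neg \<phi> \<in> formulas L V \<longleftrightarrow> \<phi> \<in> formulas L V"
  by (auto simp: formulas_def)

lemma formulas_mono: "V \<subseteq> W \<Longrightarrow> formulas L V \<subseteq> formulas L W"
  by (auto simp: formulas_def)

definition rename :: "('v \<Rightarrow> 'w) \<Rightarrow> ('f, 'r, 'v) fm \<Rightarrow> ('f, 'r, 'w) fm" where
  "rename h = rebind_fm Inl (Inr \<circ> h) 0"

lemma rename_in_formulas:
  assumes "\<phi> \<in> formulas L V" "\<And>v. v \<in> V \<Longrightarrow> h v \<in> W"
  shows "rename h \<phi> \<in> formulas L W"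
proof -
  have wf: "wf_fm L (0 + 0) \<phi>" and V: "fm_vars \<phi> \<subseteq> V"
    using assms(1) by (auto simp: formulas_def)
  have "wf_fm L (0 + 0) (rename h \<phi>)"
    unfolding rename_def using wf by (rule wf_rebind_fm) auto
  moreover have "fm_vars (rename h \<phi>) \<subseteq> W"
    using vars_rebind_fm[OF wf, of Inl "Inr \<circ> h"] V assms(2) unfolding rename_def by auto
  ultimately show ?thesis by (auto simp: formulas_def)
qed

lemma satisfies_rename:
  assumes "\<phi> \<in> formulas L V"
  shows "satisfies S \<rho> (rename h \<phi>) \<longleftrightarrow> satisfies S (\<rho> \<circ> h) \<phi>"
  using eval_rebind_fm[of L "[]" "[]" \<phi> "[]" \<rho> Inl "Inr \<circ> h" "\<rho> \<circ> h" S] assms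
  by (auto simp: satisfies_def rename_def formulas_def)

lemma conjunction_formula:
  assumes "finite q" "q \<subseteq> formulas L V"
  obtains \<phi> where "\<phi> \<in> formulas L V" "\<And>\<rho>. satisfies S \<rho> \<phi> \<longleftrightarrow> (\<forall>\<psi>\<in>q. satisfies S \<rho> \<psi>)"
proof -
  have "\<exists>\<phi>\<in>formulas L V. \<forall>\<rho>. satisfies S \<rho> \<phi> \<longleftrightarrow> (\<forall>\<psi>\<in>q. satisfies S \<rho> \<psi>)"
    using assms
  proof (induction q rule: finite_induct)
    case empty
    then show ?case
      by (intro bexI[of _ "Neg Falsum"]) (auto simp: formulas_def satisfies_def)
  next
    case (insert \<psi> q)
    then obtain \<phi> where "\<phi> \<in> formulas L V"
      "\<And>\<rho>. satisfies S \<rho> \<phi> \<longleftrightarrow> (\<forall>\<psi>\<in>q. satisfies S \<rho> \<psi>)" by auto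
    then show ?case using insert
      by (intro bexI[of _ "Neg (Implies \<psi> (Neg \<phi>))"]) (auto simp: formulas_def satisfies_def)
  qed
  then show ?thesis using that by blast
qed

text \<open>The variable \<open>v\<close> is turned into the outermost dangling index, where the new quantifier
  binds it.\<close>

lemma exists_formula1:
  assumes "\<phi> \<in> formulas L V"
  obtains \<psi> where "\<psi> \<in> formulas L (V - {v})"
    "\<And>\<rho>. satisfies S \<rho> \<psi> \<longleftrightarrow> (\<exists>c\<in>univ S. satisfies S (\<rho>(v := c)) \<phi>)"
proof -
  let ?g = "\<lambda>w. if w = v then Inl 0 else Inr w"
  let ?\<phi> = "rebind_fm Inl ?g 0 \<phi>"
  let ?\<psi> = "Neg (Forall (Neg ?\<phi>))"
  have wf: "wf_fm L (0 + 0) \<phi>" and V: "fm_vars \<phi> \<subseteq> V"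
    using assms(1) by (auto simp: formulas_def)
  have "wf_fm L (0 + 1) ?\<phi>"
    using wf by (rule wf_rebind_fm) (auto split: if_splits)
  moreover have "fm_vars ?\<phi> \<subseteq> V - {v}"
    using vars_rebind_fm[OF wf, of Inl ?g] V by (auto split: if_splits)
  ultimately have 1: "?\<psi> \<in> formulas L (V - {v})" by (auto simp: formulas_def)
  have "eval_fm S [c] \<rho> ?\<phi> = eval_fm S [] (\<rho>(v := c)) \<phi>" for \<rho> c
    using eval_rebind_fm[of L "[]" "[]" \<phi> "[c]" \<rho> Inl ?g "\<rho>(v := c)" S] wf by auto
  then have "\<And>\<rho>. satisfies S \<rho> ?\<psi> \<longleftrightarrow> (\<exists>c\<in>univ S. satisfies S (\<rho>(v := c)) \<phi>)"
    by (simp add: satisfies_def)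
  then show ?thesis using 1 that by blast
qed

text \<open>Here \<open>univ S = UNIV\<close> makes every assignment a legitimate one, so that a block of quantifiers
  amounts to a change of the assignment on \<open>F\<close>.\<close>

lemma exists_formula:
  assumes "finite F" "\<phi> \<in> formulas L V" "univ S = UNIV"
  obtains \<psi> where "\<psi> \<in> formulas L (V - F)"
    "\<And>\<rho>. satisfies S \<rho> \<psi> \<longleftrightarrow> (\<exists>\<rho>'. (\<forall>v. v \<notin> F \<longrightarrow> \<rho>' v = \<rho> v) \<and> satisfies S \<rho>' \<phi>)"
proof -
  have "\<exists>\<psi>\<in>formulas L (V - F).
    \<forall>\<rho>. satisfies S \<rho> \<psi> \<longleftrightarrow> (\<exists>\<rho>'. (\<forall>v. v \<notin> F \<longrightarrow> \<rho>' v = \<rho> v) \<and> satisfies S \<rho>' \<phi>)"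
    using assms(1)
  proof (induction F rule: finite_induct)
    case empty
    have "\<rho>' = \<rho>" if "\<forall>v. v \<notin> {} \<longrightarrow> \<rho>' v = \<rho> v" for \<rho>' \<rho> :: "'a \<Rightarrow> 'd"
      using that by auto
    then show ?case using assms(2) by (intro bexI[of _ \<phi>]) auto
  next
    case (insert x F)
    then obtain \<psi> where \<psi>: "\<psi> \<in> formulas L (V - F)"
      "\<And>\<rho>. satisfies S \<rho> \<psi> \<longleftrightarrow> (\<exists>\<rho>'. (\<forall>v. v \<notin> F \<longrightarrow> \<rho>' v = \<rho> v) \<and> satisfies S \<rho>' \<phi>)" by auto
    obtain \<theta> where \<theta>: "\<theta> \<in> formulas L (V - F - {x})"
      "\<And>\<rho>. satisfies S \<rho> \<theta> \<longleftrightarrow> (\<exists>c\<in>univ S. satisfies S (\<rho>(x := c)) \<psi>)"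
      using exists_formula1[OF \<psi>(1), of x S] by blast
    have "satisfies S \<rho> \<theta> \<longleftrightarrow> (\<exists>\<rho>'. (\<forall>v. v \<notin> insert x F \<longrightarrow> \<rho>' v = \<rho> v) \<and> satisfies S \<rho>' \<phi>)"
      (is "_ \<longleftrightarrow> ?R") for \<rho>
    proof
      assume "satisfies S \<rho> \<theta>"
      then obtain c \<rho>' where "\<forall>v. v \<notin> F \<longrightarrow> \<rho>' v = (\<rho>(x := c)) v" "satisfies S \<rho>' \<phi>"
        unfolding \<theta>(2) \<psi>(2) by auto
      then show ?R by (intro exI[of _ \<rho>']) auto
    next
      assume ?R
      then obtain \<rho>' where "\<forall>v. v \<notin> insert x F \<longrightarrow> \<rho>' v = \<rho> v" "satisfies S \<rho>' \<phi>" by auto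
      then show "satisfies S \<rho> \<theta>" unfolding \<theta>(2) \<psi>(2) assms(3)
        by (intro bexI[of _ "\<rho>' x"] exI[of _ \<rho>']) auto
    qed
    moreover have "V - F - {x} = V - insert x F" by auto
    ultimately show ?case using \<theta>(1) by auto
  qed
  then show ?thesis using that by blast
qed

section \<open>Automorphisms\<close>

text \<open>An automorphism of a structure on \<open>UNIV\<close> maps each subset, with the operations and relations
  that \<open>C\<close> has there, isomorphically onto its image.\<close>

lemma eval_tm_aut:
  assumes "is_aut L C f" "\<And>v. \<rho>' v = f (\<rho> v)" "wf_tm L (length xs) t"
  shows "eval_tm (C\<lparr>univ := f ` U\<rparr>) (map f xs) \<rho>' t = f (eval_tm (C\<lparr>univ := U\<rparr>) xs \<rho> t)"
  using assms(3)
proof (induction t)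
  case (App F ts)
  have "map (eval_tm (C\<lparr>univ := f ` U\<rparr>) (map f xs) \<rho>') ts
    = map f (map (eval_tm (C\<lparr>univ := U\<rparr>) xs \<rho>) ts)"
    using App by auto
  then show ?case using App.prems assms(1)
    by (simp add: is_aut_def del: map_map)
qed (use assms(2) in auto)

lemma eval_fm_aut:
  assumes "is_aut L C f" "\<And>v. \<rho>' v = f (\<rho> v)" "wf_fm L (length xs) \<phi>"
  shows "eval_fm (C\<lparr>univ := f ` U\<rparr>) (map f xs) \<rho>' \<phi> = eval_fm (C\<lparr>univ := U\<rparr>) xs \<rho> \<phi>"
  using assms(3)
proof (induction \<phi> arbitrary: xs)
  case (Equal s t)
  have "inj f" using assms(1) by (auto simp: is_aut_def bij_def)
  then show ?case using Equal by (simp add: eval_tm_aut[OF assms(1,2)] inj_eq)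
next
  case (Pred R ts)
  have "map (eval_tm (C\<lparr>univ := f ` U\<rparr>) (map f xs) \<rho>') ts
    = map f (map (eval_tm (C\<lparr>univ := U\<rparr>) xs \<rho>) ts)"
    using Pred by (auto intro!: eval_tm_aut[OF assms(1,2)])
  then show ?case using Pred.prems assms(1)
    by (simp add: is_aut_def del: map_map)
next
  case (Forall \<phi>)
  then show ?case using Forall.IH[of "_ # xs"] by auto
qed (use assms(2) in auto)

lemma satisfies_aut:
  assumes "is_aut L C f" "\<phi> \<in> formulas L V" "univ C = UNIV"
  shows "satisfies C (f \<circ> \<rho>) \<phi> \<longleftrightarrow> satisfies C \<rho> \<phi>"
proof -
  have "C\<lparr>univ := UNIV\<rparr> = C" using assms(3) by (cases C) auto
  moreover have "f ` UNIV = UNIV" using assms(1) by (auto simp: is_aut_def bij_def)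
  ultimately show ?thesis
    using eval_fm_aut[OF assms(1), of "f \<circ> \<rho>" \<rho> "[]" \<phi> UNIV] assms(2)
    by (simp add: satisfies_def formulas_def)
qed

lemma is_aut_id: "is_aut L C id"
  by (simp add: is_aut_def)

lemma is_aut_comp: "is_aut L C f \<Longrightarrow> is_aut L C g \<Longrightarrow> is_aut L C (f \<circ> g)"
  unfolding is_aut_def by (simp add: bij_comp flip: map_map)

lemma is_aut_inv:
  assumes "is_aut L C f"
  shows "is_aut L C (inv_into UNIV f)"
proof -
  let ?g = "inv_into UNIV f"
  have bij: "bij f" using assms by (simp add: is_aut_def)
  then have g: "?g (f x) = x" "f (?g x) = x" for x
    by (simp_all add: bij_is_inj bij_is_surj surj_f_inv_f)
  have map: "map f (map ?g xs) = xs" for xs by (simp add: g map_idI)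
  have "?g (fun_int C F xs) = fun_int C F (map ?g xs)"
    if "F \<in> Funs L" "length xs = fun_arity L F" for F xs
  proof -
    have "f (fun_int C F (map ?g xs)) = fun_int C F (map f (map ?g xs))"
      using assms that by (simp add: is_aut_def)
    then have "f (fun_int C F (map ?g xs)) = fun_int C F xs" by (simp only: map)
    then show ?thesis using g(1) by metis
  qed
  moreover have "rel_int C R (map ?g xs) = rel_int C R xs"
    if "R \<in> Rels L" "length xs = rel_arity L R" for R xs
  proof -
    have "rel_int C R (map f (map ?g xs)) = rel_int C R (map ?g xs)"
      using assms that by (simp add: is_aut_def del: map_map)
    then show ?thesis by (simp only: map)
  qed
  ultimately show ?thesis using bij by (simp add: is_aut_def bij_imp_bij_inv)
qed

section \<open>Sets of size less than an uncountable cardinal\<close>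

inductive_set generated :: "('o \<Rightarrow> 'a list \<Rightarrow> 'a) \<Rightarrow> 'o set \<Rightarrow> 'a set \<Rightarrow> 'a set"
  for op :: "'o \<Rightarrow> 'a list \<Rightarrow> 'a" and Ops :: "'o set" and A :: "'a set" where
  base: "a \<in> A \<Longrightarrow> a \<in> generated op Ops A"
| step: "k \<in> Ops \<Longrightarrow> \<forall>x\<in>set xs. x \<in> generated op Ops A \<Longrightarrow> op k xs \<in> generated op Ops A"

fun rpn_step :: "('o \<Rightarrow> 'a list \<Rightarrow> 'a) \<Rightarrow> 'a + 'o \<times> nat \<Rightarrow> 'a list \<Rightarrow> 'a list" where
  "rpn_step op (Inl a) st = a # st"
| "rpn_step op (Inr (k, n)) st = op k (rev (take n st)) # drop n st"

text \<open>Words in reverse Polish notation enumerate the generated elements, so there are at most as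
  many of these as finite sequences of generators and operations.\<close>

lemma generated_by_word:
  assumes "x \<in> generated op Ops A"
  shows "\<exists>w\<in>lists (A <+> Ops \<times> UNIV). \<forall>st. fold (rpn_step op) w st = x # st"
  using assms
proof induction
  case (base a)
  then show ?case by (intro bexI[of _ "[Inl a]"]) auto
next
  case (step k xs)
  have "\<exists>w\<in>lists (A <+> Ops \<times> UNIV). \<forall>st. fold (rpn_step op) w st = rev ys @ st"
    if "set ys \<subseteq> set xs" for ys
    using that
  proof (induction ys rule: rev_induct)
    case Nil
    then show ?case by (intro bexI[of _ "[]"]) auto
  next
    case (snoc y ys)
    obtain w where w: "w \<in> lists (A <+> Ops \<times> UNIV)" "\<forall>st. fold (rpn_step op) w st = rev ys @ st"
      using snoc by auto
    obtain v where v: "v \<in> lists (A <+> Ops \<times> UNIV)" "\<forall>st. fold (rpn_step op) v st = y # st"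
      using snoc.prems step by fastforce
    show ?case by (intro bexI[of _ "w @ v"]) (use w v in auto)
  qed
  then obtain w where w: "w \<in> lists (A <+> Ops \<times> UNIV)"
    "\<forall>st. fold (rpn_step op) w st = rev xs @ st" by blast
  have "\<forall>st. fold (rpn_step op) (w @ [Inr (k, length xs)]) st = op k xs # st"
    using w by simp
  then show ?case
    using w step(1) by (intro bexI[of _ "w @ [Inr (k, length xs)]"]) auto
qed

locale uncountable_cardinal =
  fixes \<kappa> :: "'k rel"
  assumes Card: "Card_order \<kappa>" and uncountable: "natLeq <o \<kappa>"
begin

lemma small_subset: "|B| <o \<kappa> \<Longrightarrow> A \<subseteq> B \<Longrightarrow> |A| <o \<kappa>"
  using card_of_mono1 ordLeq_ordLess_trans by blast

lemma small_image: "|A| <o \<kappa> \<Longrightarrow> |f ` A| <o \<kappa>"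
  using card_of_image ordLeq_ordLess_trans by blast

lemma small_nat: "|UNIV :: nat set| <o \<kappa>"
  using card_of_nat uncountable ordIso_ordLess_trans by blast

lemma infinite_Field: "infinite (Field \<kappa>)"
proof -
  have "|UNIV :: nat set| \<le>o |Field \<kappa>|"
    using card_of_mono2[OF ordLess_imp_ordLeq[OF uncountable]] by (simp add: Field_natLeq)
  then show ?thesis by (rule card_of_ordLeq_infinite) simp
qed

lemma small_Plus: "|A| <o \<kappa> \<Longrightarrow> |B| <o \<kappa> \<Longrightarrow> |A <+> B| <o \<kappa>"
  using card_of_Plus_ordLess_infinite_Field infinite_Field Card by blast

lemma small_Un: "|A| <o \<kappa> \<Longrightarrow> |B| <o \<kappa> \<Longrightarrow> |A \<union> B| <o \<kappa>"
  using card_of_Un_ordLess_infinite_Field infinite_Field Card by blast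

lemma small_finite: "finite A \<Longrightarrow> |A| <o \<kappa>"
  using finite_ordLess_infinite[OF card_of_Well_order, of \<kappa> A] Card infinite_Field
  by (auto simp: Field_card_of card_order_on_def)

lemma small_Times:
  assumes "|A| <o \<kappa>" "|B| <o \<kappa>"
  shows "|A \<times> B| <o \<kappa>"
proof -
  let ?Z = "(A <+> B) <+> (UNIV :: nat set)"
  have Z: "|?Z| <o \<kappa>" by (intro small_Plus assms small_nat)
  have inf: "infinite ?Z" by (simp add: finite_Plus_iff)
  have A: "|A| \<le>o |?Z|" by (rule ordLeq_transitive[OF card_of_Plus1 card_of_Plus1])
  have B: "|B| \<le>o |?Z|" by (rule ordLeq_transitive[OF card_of_Plus2 card_of_Plus1])
  then have "|A \<times> B| \<le>o |?Z|"
    by (intro card_of_Sigma_ordLeq_infinite[OF inf A] ballI B)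
  then show ?thesis using Z by (rule ordLeq_ordLess_trans)
qed

lemma small_lists:
  assumes "|A| <o \<kappa>"
  shows "|lists A| <o \<kappa>"
proof -
  let ?Z = "A <+> (UNIV :: nat set)"
  have Z: "|?Z| <o \<kappa>" by (intro small_Plus assms small_nat)
  have inf: "infinite ?Z" by (simp add: finite_Plus_iff)
  have A: "|A| \<le>o |?Z|" by (simp add: card_of_Plus1)
  have "|{xs \<in> lists A. length xs = n}| \<le>o |?Z|" for n
  proof (induction n)
    case 0
    have "{xs \<in> lists A. length xs = 0} = {[]}" by auto
    then show ?case using inf by (simp add: card_of_singl_ordLeq)
  next
    case (Suc n)
    let ?B = "{xs \<in> lists A. length xs = n}"
    have "{xs \<in> lists A. length xs = Suc n} = (\<lambda>(x, xs). x # xs) ` (A \<times> ?B)"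
      by (auto simp: length_Suc_conv image_iff)
    then have "|{xs \<in> lists A. length xs = Suc n}| \<le>o |A \<times> ?B|" by (simp add: card_of_image)
    moreover have "|A \<times> ?B| \<le>o |?Z|"
      by (intro card_of_Sigma_ordLeq_infinite[OF inf A] ballI Suc)
    ultimately show ?case by (rule ordLeq_transitive)
  qed
  then have "|\<Union>n. {xs \<in> lists A. length xs = n}| \<le>o |?Z|"
    by (intro card_of_UNION_ordLeq_infinite[OF inf]) (auto simp: card_of_Plus2)
  moreover have "(\<Union>n. {xs \<in> lists A. length xs = n}) = lists A" by auto
  ultimately have "|lists A| \<le>o |?Z|" by simp
  then show ?thesis using Z by (rule ordLeq_ordLess_trans)
qed

lemma small_generated:
  assumes "|A| <o \<kappa>" "|Ops| <o \<kappa>"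
  shows "|generated op Ops A| <o \<kappa>"
proof -
  have "generated op Ops A
      \<subseteq> (\<lambda>w. hd (fold (rpn_step op) w [])) ` lists (A <+> Ops \<times> UNIV)"
  proof
    fix x assume "x \<in> generated op Ops A"
    then obtain w where "w \<in> lists (A <+> Ops \<times> UNIV)" "fold (rpn_step op) w [] = [x]"
      using generated_by_word[of x op Ops A] by auto
    then show "x \<in> (\<lambda>w. hd (fold (rpn_step op) w [])) ` lists (A <+> Ops \<times> UNIV)"
      by (intro image_eqI[of _ _ w]) auto
  qed
  then show ?thesis
    by (rule small_subset[rotated]) (intro small_image small_lists small_Plus small_Times small_nat assms)
qed

text \<open>Terms are generated from variables by the function symbols, and formulas from atomic ones by
  the connectives and the quantifier.\<close>

lemma small_formulas:
  fixes L :: "('f, 'r) language" and V :: "'v set"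
  assumes L: "|Funs L <+> Rels L| <o \<kappa>" and V: "|V| <o \<kappa>"
  shows "|formulas L V| <o \<kappa>"
proof -
  have Fun: "|Funs L| <o \<kappa>" by (rule ordLeq_ordLess_trans[OF card_of_Plus1 L])
  have Rel: "|Rels L| <o \<kappa>" by (rule ordLeq_ordLess_trans[OF card_of_Plus2 L])
  define Tm :: "('f, 'v) tm set" where
    "Tm = generated App (Funs L) (range BVar \<union> FVar ` V)"
  have Tm: "|Tm| <o \<kappa>" unfolding Tm_def
    by (intro small_generated small_Un small_image small_nat V Fun)
  have in_Tm: "t \<in> Tm" if "wf_tm L n t" "tm_vars t \<subseteq> V" for n t
    using that
  proof (induction t)
    case (BVar k)
    then show ?case unfolding Tm_def by (intro generated.base) auto
  next
    case (FVar v)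
    then show ?case unfolding Tm_def by (intro generated.base) auto
  next
    case (App F ts)
    then have "F \<in> Funs L" "\<forall>t\<in>set ts. t \<in> Tm" by (auto simp: UN_subset_iff)
    then show ?case unfolding Tm_def by (rule generated.step)
  qed
  define Atoms :: "('f, 'r, 'v) fm set" where
    "Atoms = {Falsum} \<union> (\<lambda>(s, t). Equal s t) ` (Tm \<times> Tm)
      \<union> (\<lambda>(R, ts). Pred R ts) ` (Rels L \<times> lists Tm)"
  have Atoms: "|Atoms| <o \<kappa>" unfolding Atoms_def
    by (intro small_Un small_image small_Times small_lists small_finite Tm Rel) auto
  define conn :: "bool \<Rightarrow> ('f, 'r, 'v) fm list \<Rightarrow> ('f, 'r, 'v) fm" where
    "conn b xs = (if b then Implies (xs ! 0) (xs ! 1) else Forall (xs ! 0))" for b xs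
  define Fm where "Fm = generated conn UNIV Atoms"
  have "\<phi> \<in> Fm" if "wf_fm L n \<phi>" "fm_vars \<phi> \<subseteq> V" for n \<phi>
    using that
  proof (induction \<phi> arbitrary: n)
    case Falsum
    then show ?case unfolding Fm_def Atoms_def by (intro generated.base) auto
  next
    case (Equal s t)
    then show ?case unfolding Fm_def Atoms_def
      by (intro generated.base) (use in_Tm[of n] in auto)
  next
    case (Pred R ts)
    then have "ts \<in> lists Tm" using in_Tm[of n] by (auto simp: UN_subset_iff)
    then show ?case using Pred unfolding Fm_def Atoms_def by (intro generated.base) auto
  next
    case (Implies \<phi> \<psi>)
    then have "\<forall>x\<in>set [\<phi>, \<psi>]. x \<in> Fm" by auto
    then have "conn True [\<phi>, \<psi>] \<in> Fm" unfolding Fm_def by (intro generated.step) auto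
    then show ?case by (simp add: conn_def)
  next
    case (Forall \<phi>)
    then have "\<forall>x\<in>set [\<phi>]. x \<in> Fm" by auto
    then have "conn False [\<phi>] \<in> Fm" unfolding Fm_def by (intro generated.step) auto
    then show ?case by (simp add: conn_def)
  qed
  then have "formulas L V \<subseteq> Fm" by (auto simp: formulas_def)
  moreover have "|Fm| <o \<kappa>" unfolding Fm_def by (intro small_generated Atoms small_finite) auto
  ultimately show ?thesis by (rule small_subset[rotated])
qed

lemma small_enumeration:
  assumes "|A| <o \<kappa>"
  obtains l g where "l \<in> Field \<kappa>" "bij_betw g (underS \<kappa> l) A"
proof -
  have W: "Well_order \<kappa>" using Card by (simp add: card_order_on_def)
  obtain l where l: "l \<in> Field \<kappa>" "|A| =o Restr \<kappa> (underS \<kappa> l)"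
    using ordLess_iff_ordIso_Restr[OF W card_of_Well_order] assms by blast
  have "Field (Restr \<kappa> (underS \<kappa> l)) = underS \<kappa> l"
    using W by (intro Refl_Field_Restr2) (auto simp: order_on_defs underS_def Field_def)
  then obtain f where "bij_betw f A (underS \<kappa> l)"
    using l(2) by (auto simp: ordIso_def BNF_Wellorder_Embedding.iso_def Field_card_of)
  then show ?thesis using that l(1) bij_betw_inv_into by blast
qed

end

section \<open>Relatively closed sets of tuples\<close>

definition coords :: "'j set \<Rightarrow> ('j \<Rightarrow> 'm) set \<Rightarrow> 'm set" where
  "coords J B = (\<lambda>(b, j). b j) ` (B \<times> J)"

lemma coordsI: "b \<in> B \<Longrightarrow> j \<in> J \<Longrightarrow> b j \<in> coords J B"
  unfolding coords_def by (rule image_eqI[of _ _ "(b, j)"]) auto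

text \<open>A substitute for elementary substructures inside a set \<open>S\<close> of tuples: whatever formula with
  parameters from \<open>B\<close> is satisfied by tuples from \<open>S\<close> is satisfied by tuples from \<open>B\<close>.  The variables
  form a sequence of tuples, of which a formula uses only finitely many.\<close>

definition relatively_closed ::
  "('f, 'r) language \<Rightarrow> ('f, 'r, 'm) struct \<Rightarrow> 'j set \<Rightarrow> ('j \<Rightarrow> 'm) set \<Rightarrow> ('j \<Rightarrow> 'm) set \<Rightarrow> bool"
  where "relatively_closed L C J S B \<longleftrightarrow> B \<subseteq> S \<and>
    (\<forall>\<phi>\<in>formulas L ((UNIV :: nat set) \<times> J <+> coords J B).
      (\<exists>s. range s \<subseteq> S \<and> satisfies C (case_sum (\<lambda>(n, j). s n j) id) \<phi>) \<longrightarrow>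
      (\<exists>s. range s \<subseteq> B \<and> satisfies C (case_sum (\<lambda>(n, j). s n j) id) \<phi>))"

locale monster =
  fixes \<kappa> :: "'k rel" and L :: "('f, 'r) language" and T :: "('f, 'r, nat) fm set"
    and C :: "('f, 'r, 'm) struct"
  assumes monster: "monster_model \<kappa> L T C"

sublocale monster \<subseteq> uncountable_cardinal \<kappa>
  using monster by unfold_locales (auto simp: monster_model_def)

context monster
begin

lemma univ_C: "univ C = UNIV"
  using monster by (simp add: monster_model_def)

lemma small_language_formulas: "|V| <o \<kappa> \<Longrightarrow> |formulas L V| <o \<kappa>"
  using monster by (auto simp: monster_model_def intro: small_formulas)

lemma small_coords: "|J| <o \<kappa> \<Longrightarrow> |B| <o \<kappa> \<Longrightarrow> |coords J B| <o \<kappa>"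
  unfolding coords_def by (intro small_image small_Times)

text \<open>The downward Loewenheim--Skolem construction: \<open>B\<close> is generated from \<open>B0\<close> by Skolem operations,
  one for each formula and each position in a sequence witnessing it.\<close>

lemma exists_relatively_closed:
  fixes S :: "('j \<Rightarrow> 'm) set"
  assumes J: "|J| <o \<kappa>" and B0: "|B0| <o \<kappa>" "B0 \<subseteq> S"
  obtains B where "B0 \<subseteq> B" "|B| <o \<kappa>" "relatively_closed L C J S B"
proof (cases "S = {}")
  case True
  show ?thesis
    by (rule that[of "{}"]) (use True B0 in \<open>auto simp: relatively_closed_def\<close>)
next
  case False
  then obtain s0 where s0: "s0 \<in> S" by auto
  define good where "good \<phi> xs s \<longleftrightarrow> range s \<subseteq> S \<and>
    satisfies C (case_sum (\<lambda>(n, j). s n j) (\<lambda>(i, j). (xs ! i) j)) \<phi>"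
    for \<phi> :: "('f, 'r, nat \<times> 'j + nat \<times> 'j) fm" and xs :: "('j \<Rightarrow> 'm) list" and s
  define op where "op = (\<lambda>(\<phi>, n :: nat) xs. if \<exists>s. good \<phi> xs s then (SOME s. good \<phi> xs s) n else s0)"
  \<comment> \<open>A parameter is the coordinate \<open>j\<close> of the tuple number \<open>i\<close> in the argument list, hence the
    second summand \<open>UNIV \<times> J\<close>.\<close>
  define Ops :: "(('f, 'r, nat \<times> 'j + nat \<times> 'j) fm \<times> nat) set"
    where "Ops = formulas L (UNIV \<times> J <+> UNIV \<times> J) \<times> UNIV"
  define B where "B = generated op Ops B0"
  have good_some: "good \<phi> xs (\<lambda>n. op (\<phi>, n) xs)" if "good \<phi> xs s" for \<phi> xs s
  proof -
    have "\<exists>s. good \<phi> xs s" using that by blast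
    then show ?thesis unfolding op_def by (simp add: someI_ex)
  qed
  have "|B| <o \<kappa>" unfolding B_def Ops_def
    by (intro small_generated small_Times small_language_formulas small_Plus small_nat J B0)
  moreover have "B0 \<subseteq> B" unfolding B_def by (auto intro: generated.base)
  moreover have "relatively_closed L C J S B"
    unfolding relatively_closed_def
  proof (intro conjI ballI impI)
    have "op k xs \<in> S" for k xs
    proof (cases "\<exists>s. good (fst k) xs s")
      case True
      then have "good (fst k) xs (\<lambda>n. op (fst k, n) xs)" using good_some by blast
      then have "op (fst k, snd k) xs \<in> S" unfolding good_def by blast
      then show ?thesis by simp
    qed (auto simp: op_def s0 split: prod.splits)
    note op_S = this
    have "x \<in> S" if "x \<in> B" for x
      using that unfolding B_def by cases (use B0(2) op_S in \<open>simp_all only: subsetD\<close>)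
    then show "B \<subseteq> S" by blast
  next
    fix \<phi> :: "('f, 'r, nat \<times> 'j + 'm) fm"
    assume \<phi>: "\<phi> \<in> formulas L (UNIV \<times> J <+> coords J B)"
      and "\<exists>s. range s \<subseteq> S \<and> satisfies C (case_sum (\<lambda>(n, j). s n j) id) \<phi>"
    then obtain s where s: "range s \<subseteq> S" "satisfies C (case_sum (\<lambda>(n, j). s n j) id) \<phi>" by blast
    let ?P = "{a. Inr a \<in> fm_vars \<phi>}"
    have "finite ?P" using finite_vimageI[OF finite_fm_vars[of \<phi>], of Inr] by (simp add: vimage_def)
    then obtain as where as: "set as = ?P" using finite_list by blast
    have "\<forall>a\<in>?P. \<exists>b j. b \<in> B \<and> j \<in> J \<and> a = b j" using \<phi> by (force simp: formulas_def coords_def)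
    then obtain bb jj where bj: "\<And>a. a \<in> ?P \<Longrightarrow> bb a \<in> B \<and> jj a \<in> J \<and> a = bb a (jj a)"
      by metis
    have "\<forall>a\<in>?P. \<exists>i<length as. as ! i = a" using as in_set_conv_nth[of _ as] by auto
    then obtain ix where ix: "\<And>a. a \<in> ?P \<Longrightarrow> ix a < length as \<and> as ! ix a = a" by metis
    define xs where "xs = map bb as"
    have xs: "\<forall>x\<in>set xs. x \<in> B" using bj as by (auto simp: xs_def)
    have xs_ix: "(xs ! ix a) (jj a) = a" if "a \<in> ?P" for a
      using ix[OF that] bj[OF that] by (simp add: xs_def)
    let ?h = "case_sum Inl (\<lambda>a. Inr (ix a, jj a))"
    have \<phi>': "\<phi> \<in> formulas L (UNIV \<times> J <+> ?P)" using \<phi> by (force simp: formulas_def)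
    have \<psi>: "rename ?h \<phi> \<in> formulas L (UNIV \<times> J <+> UNIV \<times> J)"
      by (rule rename_in_formulas[OF \<phi>']) (use bj in auto)
    have sat: "satisfies C (case_sum t (\<lambda>(i, j). (xs ! i) j)) (rename ?h \<phi>)
        \<longleftrightarrow> satisfies C (case_sum t id) \<phi>" for t
      unfolding satisfies_rename[OF \<phi>']
      by (rule satisfies_cong_on[OF \<phi>']) (use xs_ix in auto)
    have "good (rename ?h \<phi>) xs s" unfolding good_def using s sat by blast
    then have "good (rename ?h \<phi>) xs (\<lambda>n. op (rename ?h \<phi>, n) xs)" by (rule good_some)
    moreover have "op (rename ?h \<phi>, n) xs \<in> B" for n
      unfolding B_def by (rule generated.step) (use \<psi> xs in \<open>auto simp: Ops_def B_def\<close>)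
    ultimately show "\<exists>s. range s \<subseteq> B \<and> satisfies C (case_sum (\<lambda>(n, j). s n j) id) \<phi>"
      unfolding good_def sat by (intro exI[of _ "\<lambda>n. op (rename ?h \<phi>, n) xs"]) auto
  qed
  ultimately show ?thesis using that by blast
qed

lemma eval_tm_univ: "eval_tm (C\<lparr>univ := U\<rparr>) xs \<rho> t = eval_tm C xs \<rho> t"
proof (induction t)
  case (App F ts)
  then have "map (eval_tm (C\<lparr>univ := U\<rparr>) xs \<rho>) ts = map (eval_tm C xs \<rho>) ts" by auto
  then show ?case by (simp del: map_eq_conv)
qed auto

text \<open>The Tarski--Vaught test.\<close>

lemma small_model_if_witnesses:
  assumes "|M| <o \<kappa>"
    and wit: "\<And>\<phi>. \<phi> \<in> formulas L ({()} <+> M) \<Longrightarrow> \<exists>c. satisfies C (case_sum (\<lambda>_. c) id) \<phi> \<Longrightarrow>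
      \<exists>c\<in>M. satisfies C (case_sum (\<lambda>_. c) id) \<phi>"
  shows "small_model \<kappa> L C M"
proof -
  have eval: "eval_fm (C\<lparr>univ := M\<rparr>) xs id \<phi> = eval_fm C xs id \<phi>"
    if "wf_fm L (length xs) \<phi>" "set xs \<subseteq> M" "fm_vars \<phi> \<subseteq> M" for xs \<phi>
    using that
  proof (induction \<phi> arbitrary: xs)
    case (Pred R ts)
    then show ?case by (simp add: eval_tm_univ cong: map_cong)
  next
    case (Forall \<phi>)
    have IH: "eval_fm (C\<lparr>univ := M\<rparr>) (x # xs) id \<phi> = eval_fm C (x # xs) id \<phi>" if "x \<in> M" for x
      by (rule Forall.IH) (use Forall.prems that in auto)
    have "\<exists>x\<in>M. \<not> eval_fm C (x # xs) id \<phi>" if "\<not> eval_fm C (x # xs) id \<phi>" for x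
    proof -
      \<comment> \<open>The value of the quantified variable becomes the free variable of a formula over \<open>M\<close>;
        the other dangling variables are replaced by their values.\<close>
      let ?b = "\<lambda>k. (case k of 0 \<Rightarrow> Inr (Inl ()) | Suc i \<Rightarrow> Inr (Inr (xs ! i))) :: nat + unit + 'm"
      let ?g = "\<lambda>v. Inr (Inr v) :: nat + unit + 'm"
      let ?\<psi> = "rebind_fm ?b ?g 0 \<phi>"
      have wf: "wf_fm L (0 + Suc (length xs)) \<phi>" using Forall.prems by simp
      have "wf_fm L (0 + 0) ?\<psi>"
        using wf by (rule wf_rebind_fm) (auto split: nat.splits)
      moreover have "w \<in> {()} <+> M" if w: "w \<in> fm_vars ?\<psi>" for w
      proof -
        have "(\<exists>k<Suc (length xs). ?b k = Inr w) \<or> (\<exists>v\<in>fm_vars \<phi>. ?g v = Inr w)"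
          using subsetD[OF vars_rebind_fm[OF wf, of ?b ?g] w] unfolding mem_Collect_eq .
        then show ?thesis
        proof (elim disjE exE conjE bexE)
          fix k assume "k < Suc (length xs)" "?b k = Inr w"
          then show ?thesis using Forall.prems by (cases k) auto
        qed (use Forall.prems in auto)
      qed
      ultimately have "?\<psi> \<in> formulas L ({()} <+> M)" by (auto simp: formulas_def)
      moreover have ev: "satisfies C (case_sum (\<lambda>_. c) id) ?\<psi> = eval_fm C (c # xs) id \<phi>" for c
        using eval_rebind_fm[of L "[]" "c # xs" \<phi> "[]" "case_sum (\<lambda>_. c) id" ?b ?g id C] wf
        by (auto simp: satisfies_def nth_Cons split: nat.splits)
      ultimately show ?thesis using wit[of "Neg ?\<psi>"] that by (auto simp: ev)
    qed
    then show ?case using IH univ_C unfolding id_def by auto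
  qed (auto simp: eval_tm_univ)
  have "M \<noteq> {}" using wit[of "Neg Falsum"] by (auto simp: formulas_def satisfies_def)
  moreover have "fun_int C F xs \<in> M"
    if "F \<in> Funs L" "set xs \<subseteq> M" "length xs = fun_arity L F" for F xs
  proof -
    let ?\<phi> = "Equal (FVar (Inl ())) (App F (map (\<lambda>x. FVar (Inr x)) xs))"
    have "?\<phi> \<in> formulas L ({()} <+> M)" using that by (auto simp: formulas_def)
    moreover have "satisfies C (case_sum (\<lambda>_. c) id) ?\<phi> \<longleftrightarrow> c = fun_int C F xs" for c
      by (simp add: satisfies_def comp_def)
    ultimately show ?thesis using wit[of ?\<phi>] by auto
  qed
  ultimately have "is_structure L (C\<lparr>univ := M\<rparr>)" by (auto simp: is_structure_def lists_eq_set)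
  then show ?thesis using assms(1) eval[of "[]"]
    by (auto simp: small_model_def satisfies_def formulas_def)
qed

text \<open>A relatively closed set of 1-tuples among all 1-tuples passes the Tarski--Vaught test.\<close>

lemma exists_small_model:
  assumes "|A| <o \<kappa>"
  obtains M where "A \<subseteq> M" "small_model \<kappa> L C M"
proof -
  obtain B where B: "(\<lambda>a (_ :: unit). a) ` A \<subseteq> B" "|B| <o \<kappa>"
    "relatively_closed L C {()} (UNIV :: (unit \<Rightarrow> 'm) set) B"
    using exists_relatively_closed[of "{()}" "(\<lambda>a (_ :: unit). a) ` A" UNIV] assms
    by (auto simp: small_finite small_image)
  define M where "M = coords {()} B"
  have "small_model \<kappa> L C M"
  proof (rule small_model_if_witnesses)
    show "|M| <o \<kappa>" unfolding M_def by (intro small_coords small_finite B) auto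
  next
    fix \<phi> :: "('f, 'r, unit + 'm) fm"
    assume \<phi>: "\<phi> \<in> formulas L ({()} <+> M)" and "\<exists>c. satisfies C (case_sum (\<lambda>_. c) id) \<phi>"
    then obtain c where c: "satisfies C (case_sum (\<lambda>_. c) id) \<phi>" by blast
    let ?h = "map_sum (\<lambda>u. (0 :: nat, u)) id"
    have \<psi>: "rename ?h \<phi> \<in> formulas L (UNIV \<times> {()} <+> M)"
      by (rule rename_in_formulas[OF \<phi>]) auto
    have sat: "satisfies C (case_sum (\<lambda>(n, j). s n j) id) (rename ?h \<phi>)
        \<longleftrightarrow> satisfies C (case_sum (\<lambda>_. s (0 :: nat) ()) id) \<phi>" for s
      unfolding satisfies_rename[OF \<phi>] by (rule satisfies_cong) (auto split: sum.splits)
    have "\<exists>s. range s \<subseteq> B \<and> satisfies C (case_sum (\<lambda>(n, j). s n j) id) (rename ?h \<phi>)"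
      using B(3) \<psi> c sat[of "\<lambda>_ _. c"] unfolding relatively_closed_def M_def by blast
    then have "\<exists>s. range s \<subseteq> B \<and> satisfies C (case_sum (\<lambda>_. s (0 :: nat) ()) id) \<phi>"
      unfolding sat .
    then obtain s where "range s \<subseteq> B" "satisfies C (case_sum (\<lambda>_. s (0 :: nat) ()) id) \<phi>"
      by blast
    then show "\<exists>c\<in>M. satisfies C (case_sum (\<lambda>_. c) id) \<phi>"
      unfolding M_def coords_def
      by (intro bexI[of _ "s (0 :: nat) ()"] image_eqI[of _ _ "(s 0, ())"]) auto
  qed
  moreover have "A \<subseteq> M" using B(1) by (force simp: M_def coords_def)
  ultimately show ?thesis using that by blast
qed

lemma small_model_aut:
  assumes f: "is_aut L C f" and M: "small_model \<kappa> L C M"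
  shows "small_model \<kappa> L C (f ` M)"
proof -
  let ?g = "inv_into UNIV f"
  have inv: "f (?g x) = x" "?g (f x) = x" for x
    using f by (simp_all add: is_aut_def bij_is_surj surj_f_inv_f bij_is_inj)
  have "fun_int C F xs \<in> f ` M" if F: "F \<in> Funs L" and xs: "xs \<in> lists (f ` M)" "length xs = fun_arity L F"
    for F xs
  proof -
    obtain ys where ys: "xs = map f ys" "ys \<in> lists M"
      using xs(1) unfolding lists_image by auto
    then have "fun_int C F ys \<in> M"
      using M F xs by (simp add: small_model_def is_structure_def)
    moreover have "fun_int C F xs = f (fun_int C F ys)"
      using f F xs ys by (simp add: is_aut_def)
    ultimately show ?thesis by simp
  qed
  moreover have "satisfies (C\<lparr>univ := f ` M\<rparr>) id \<phi> \<longleftrightarrow> satisfies C id \<phi>"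
    if \<phi>: "\<phi> \<in> formulas L (f ` M)" for \<phi>
  proof -
    have "satisfies (C\<lparr>univ := f ` M\<rparr>) id \<phi> \<longleftrightarrow> satisfies (C\<lparr>univ := M\<rparr>) ?g \<phi>"
      using eval_fm_aut[OF f, of id "?g" "[]" \<phi> M] \<phi>
      by (simp add: satisfies_def formulas_def inv)
    also have "\<dots> \<longleftrightarrow> satisfies (C\<lparr>univ := M\<rparr>) id (rename ?g \<phi>)"
      by (simp add: satisfies_rename[OF \<phi>])
    also have "\<dots> \<longleftrightarrow> satisfies C id (rename ?g \<phi>)"
    proof -
      have "rename ?g \<phi> \<in> formulas L M"
        by (rule rename_in_formulas[OF \<phi>]) (auto simp: inv)
      then show ?thesis using M by (simp add: small_model_def)
    qed
    also have "\<dots> \<longleftrightarrow> satisfies C ?g \<phi>"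
      by (simp add: satisfies_rename[OF \<phi>])
    also have "\<dots> \<longleftrightarrow> satisfies C (f \<circ> ?g) \<phi>"
      using satisfies_aut[OF f \<phi> univ_C] by simp
    also have "f \<circ> ?g = id" by (auto simp: inv)
    finally show ?thesis .
  qed
  ultimately show ?thesis
    using M by (auto simp: small_model_def is_structure_def small_image)
qed

end

section \<open>Saturation and homogeneity for tuples\<close>

text \<open>The Teichmueller--Tukey lemma.\<close>

lemma maximal_of_finite_character:
  assumes "\<forall>F. finite F \<and> F \<subseteq> A \<longrightarrow> Q F"
  shows "\<exists>M. A \<subseteq> M \<and> (\<forall>F. finite F \<and> F \<subseteq> M \<longrightarrow> Q F) \<and>
    (\<forall>x. (\<forall>F. finite F \<and> F \<subseteq> insert x M \<longrightarrow> Q F) \<longrightarrow> x \<in> M)"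
proof -
  let ?\<A> = "{X. A \<subseteq> X \<and> (\<forall>F. finite F \<and> F \<subseteq> X \<longrightarrow> Q F)}"
  have "\<exists>M\<in>?\<A>. \<forall>X\<in>?\<A>. M \<subseteq> X \<longrightarrow> X = M"
  proof (rule subset_Zorn_nonempty)
    show "?\<A> \<noteq> {}" using assms by blast
  next
    fix \<C> assume \<C>: "\<C> \<noteq> {}" "subset.chain ?\<A> \<C>"
    have "Q F" if F: "finite F" "F \<subseteq> \<Union>\<C>" for F
    proof -
      obtain X where "X \<in> \<C>" "F \<subseteq> X" using finite_subset_Union_chain[OF F \<C>] by blast
      then show ?thesis using \<C>(2) F(1) by (auto simp: subset.chain_def)
    qed
    moreover have "A \<subseteq> \<Union>\<C>"
    proof -
      obtain X where X: "X \<in> \<C>" using \<C>(1) by blast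
      then have "A \<subseteq> X" using \<C>(2) unfolding subset.chain_def by blast
      then show ?thesis using X by blast
    qed
    ultimately show "\<Union>\<C> \<in> ?\<A>" by blast
  qed
  then obtain M where M: "M \<in> ?\<A>" "\<forall>X\<in>?\<A>. M \<subseteq> X \<longrightarrow> X = M"
    by (elim bexE)
  have "x \<in> M" if "\<forall>F. finite F \<and> F \<subseteq> insert x M \<longrightarrow> Q F" for x
  proof -
    have "insert x M \<in> ?\<A>" using M(1) that by auto
    with M(2) have "insert x M = M" by blast
    then show ?thesis by blast
  qed
  then show ?thesis using M(1) by (intro exI[of _ M]) simp
qed

context monster
begin

lemma saturatedD:
  assumes "|A| <o \<kappa>" "p \<subseteq> formulas L ({()} <+> A)"
    "\<forall>q. finite q \<and> q \<subseteq> p \<longrightarrow> (\<exists>c. \<forall>\<phi>\<in>q. satisfies C (case_sum (\<lambda>_. c) id) \<phi>)"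
  shows "\<exists>c. \<forall>\<phi>\<in>p. satisfies C (case_sum (\<lambda>_. c) id) \<phi>"
proof -
  have "saturated \<kappa> L C" using monster by (simp add: monster_model_def)
  then show ?thesis using assms unfolding saturated_def by simp
qed

lemma strongly_homogeneousD:
  assumes "|A| <o \<kappa>" "\<forall>\<phi>\<in>formulas L A. satisfies C g \<phi> \<longleftrightarrow> satisfies C id \<phi>"
  shows "\<exists>f. is_aut L C f \<and> (\<forall>a\<in>A. f a = g a)"
proof -
  have "strongly_homogeneous \<kappa> L C" using monster by (simp add: monster_model_def)
  then show ?thesis using assms unfolding strongly_homogeneous_def by simp
qed

text \<open>Saturation speaks about types in one variable.  A type in a small tuple of variables is realized
  by a maximal set \<open>M\<close> of pairs, variable and value, that is finitely consistent with the type.  It is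
  defined on all variables: for a further variable \<open>w\<close>, the conditions that the existence of the
  remaining values puts on the value of \<open>w\<close> form a type in one variable over the values in \<open>M\<close>.\<close>

lemma realize_type_extending:
  fixes p :: "('f, 'r, 'w) fm set"
  assumes W: "|W| <o \<kappa>" and p: "p \<subseteq> formulas L W" and D: "D \<subseteq> W"
    and fin_sat: "\<And>q. finite q \<Longrightarrow> q \<subseteq> p \<Longrightarrow> \<exists>u. (\<forall>w\<in>D. u w = g w) \<and> (\<forall>\<phi>\<in>q. satisfies C u \<phi>)"
  obtains u where "\<And>w. w \<in> D \<Longrightarrow> u w = g w" "\<And>\<phi>. \<phi> \<in> p \<Longrightarrow> satisfies C u \<phi>"
proof -
  define Q where "Q F \<longleftrightarrow> F \<subseteq> W \<times> UNIV \<and> (\<forall>q. finite q \<and> q \<subseteq> p \<longrightarrow>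
    (\<exists>u. (\<forall>(w, a)\<in>F. u w = a) \<and> (\<forall>\<phi>\<in>q. satisfies C u \<phi>)))" for F :: "('w \<times> 'm) set"
  have "Q F" if "F \<subseteq> (\<lambda>w. (w, g w)) ` D" for F
    unfolding Q_def
  proof (intro conjI allI impI)
    show "F \<subseteq> W \<times> UNIV" using that D by auto
    fix q assume "finite q \<and> q \<subseteq> p"
    then obtain u where "\<forall>w\<in>D. u w = g w" "\<forall>\<phi>\<in>q. satisfies C u \<phi>" using fin_sat by blast
    then show "\<exists>u. (\<forall>(w, a)\<in>F. u w = a) \<and> (\<forall>\<phi>\<in>q. satisfies C u \<phi>)"
      using that by (intro exI[of _ u]) auto
  qed
  then have "\<forall>F. finite F \<and> F \<subseteq> (\<lambda>w. (w, g w)) ` D \<longrightarrow> Q F" by blast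
  from maximal_of_finite_character[OF this]
  obtain M where M: "(\<lambda>w. (w, g w)) ` D \<subseteq> M" "\<forall>F. finite F \<and> F \<subseteq> M \<longrightarrow> Q F"
    and M_max: "\<forall>x. (\<forall>F. finite F \<and> F \<subseteq> insert x M \<longrightarrow> Q F) \<longrightarrow> x \<in> M"
    by (elim exE conjE)
  have single: "a = b" if ab: "(w, a) \<in> M" "(w, b) \<in> M" for w a b
  proof -
    have "Q {(w, a), (w, b)}" using M(2) ab by simp
    then have "\<exists>u. (\<forall>(w', a')\<in>{(w, a), (w, b)}. u w' = a') \<and> (\<forall>\<phi>\<in>{}. satisfies C u \<phi>)"
      unfolding Q_def by blast
    then show ?thesis by auto
  qed
  define Dm where "Dm = fst ` M"
  define m where "m w = (THE a. (w, a) \<in> M)" for w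
  have m: "m w = a" if "(w, a) \<in> M" for w a
    unfolding m_def using that single by (intro the_equality) auto
  have m_in: "(w, m w) \<in> M" if "w \<in> Dm" for w using that m by (auto simp: Dm_def)
  have "M \<subseteq> W \<times> UNIV"
  proof
    fix x assume "x \<in> M"
    then have "Q {x}" using M(2) by simp
    then show "x \<in> W \<times> UNIV" by (simp add: Q_def)
  qed
  then have DmW: "Dm \<subseteq> W" by (auto simp: Dm_def)
  have full: "\<exists>u. (\<forall>w\<in>Dm. u w = m w) \<and> (\<forall>\<phi>\<in>q. satisfies C u \<phi>)"
    if q: "finite q" "q \<subseteq> p" for q
  proof -
    let ?V = "\<Union>(fm_vars ` q)"
    have "finite ?V" using q by (simp add: finite_fm_vars)
    then have "finite ((\<lambda>w. (w, m w)) ` (Dm \<inter> ?V))" by blast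
    moreover have "(\<lambda>w. (w, m w)) ` (Dm \<inter> ?V) \<subseteq> M" using m_in by blast
    ultimately have "Q ((\<lambda>w. (w, m w)) ` (Dm \<inter> ?V))" using M(2) by blast
    then have "\<exists>u. (\<forall>(w, a)\<in>(\<lambda>w. (w, m w)) ` (Dm \<inter> ?V). u w = a) \<and> (\<forall>\<phi>\<in>q. satisfies C u \<phi>)"
      using q unfolding Q_def by blast
    then obtain u where u: "\<forall>w\<in>Dm \<inter> ?V. u w = m w" "\<forall>\<phi>\<in>q. satisfies C u \<phi>"
      by auto
    let ?u = "\<lambda>w. if w \<in> Dm then m w else u w"
    have "satisfies C ?u \<phi> = satisfies C u \<phi>" if \<phi>: "\<phi> \<in> q" for \<phi>
    proof (rule satisfies_cong)
      fix v assume "v \<in> fm_vars \<phi>"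
      then have "u v = m v" if "v \<in> Dm" using u(1) \<phi> that by blast
      then show "?u v = u v" by simp
    qed
    then show ?thesis using u(2) by (intro exI[of _ ?u]) auto
  qed
  have "w \<in> Dm" if w: "w \<in> W" for w
  proof (rule ccontr)
    assume "w \<notin> Dm"
    \<comment> \<open>The formula \<open>\<theta>\<close> for a finite part \<open>q\<close> of the type quantifies out all variables other than
      \<open>w\<close> that have no value yet.\<close>
    let ?qs = "{q. finite q \<and> q \<subseteq> p}"
    have "\<forall>q\<in>?qs. \<exists>\<theta>. \<theta> \<in> formulas L ({()} <+> m ` Dm) \<and>
        (\<forall>c. satisfies C (case_sum (\<lambda>_. c) id) \<theta> \<longleftrightarrow>
          (\<exists>u. (\<forall>w\<in>Dm. u w = m w) \<and> u w = c \<and> (\<forall>\<phi>\<in>q. satisfies C u \<phi>)))"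
    proof
      fix q assume "q \<in> ?qs"
      then have q: "finite q" "q \<subseteq> p" by auto
      obtain \<phi> where \<phi>: "\<phi> \<in> formulas L W"
        "\<And>\<rho>. satisfies C \<rho> \<phi> \<longleftrightarrow> (\<forall>\<psi>\<in>q. satisfies C \<rho> \<psi>)"
        by (rule conjunction_formula[where S = C, OF q(1) subset_trans[OF q(2) p]]) (rule that)
      let ?V = "fm_vars \<phi>" and ?F = "fm_vars \<phi> - Dm - {w}"
      have \<phi>V: "\<phi> \<in> formulas L ?V" using \<phi>(1) by (simp add: formulas_def)
      have "finite ?F" by (simp add: finite_fm_vars)
      obtain \<psi> where \<psi>: "\<psi> \<in> formulas L (?V - ?F)" "\<And>\<rho>. satisfies C \<rho> \<psi> \<longleftrightarrow>
          (\<exists>\<rho>'. (\<forall>v. v \<notin> ?F \<longrightarrow> \<rho>' v = \<rho> v) \<and> satisfies C \<rho>' \<phi>)"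
        by (rule exists_formula[OF \<open>finite ?F\<close> \<phi>V univ_C]) (rule that)
      let ?h = "\<lambda>v. if v = w then Inl () else Inr (m v)"
      have "rename ?h \<psi> \<in> formulas L ({()} <+> m ` Dm)"
        by (rule rename_in_formulas[OF \<psi>(1)]) auto
      moreover have "satisfies C (case_sum (\<lambda>_. c) id) (rename ?h \<psi>) \<longleftrightarrow>
        (\<exists>u. (\<forall>w\<in>Dm. u w = m w) \<and> u w = c \<and> (\<forall>\<phi>\<in>q. satisfies C u \<phi>))" (is "?l \<longleftrightarrow> ?r") for c
      proof
        assume ?l
        then have "\<exists>\<rho>. (\<forall>v. v \<notin> ?F \<longrightarrow> \<rho> v = (case_sum (\<lambda>_. c) id \<circ> ?h) v) \<and> satisfies C \<rho> \<phi>"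
          by (simp only: satisfies_rename[OF \<psi>(1)] \<psi>(2))
        then obtain \<rho> where "\<forall>v. v \<notin> ?F \<longrightarrow> \<rho> v = (case_sum (\<lambda>_. c) id \<circ> ?h) v"
          and sat_\<rho>: "satisfies C \<rho> \<phi>" by blast
        then have \<rho>: "\<rho> v = (if v = w then c else m v)" if "v \<notin> ?F" for v
          using that by simp
        let ?u = "\<lambda>v. if v = w then c else if v \<in> Dm then m v else \<rho> v"
        have "satisfies C ?u \<phi> = satisfies C \<rho> \<phi>"
          by (rule satisfies_cong) (use \<rho> in auto)
        then have "satisfies C ?u \<phi>" using sat_\<rho> by simp
        then show ?r using \<phi>(2) \<open>w \<notin> Dm\<close> by (intro exI[of _ ?u]) auto
      next
        assume ?r
        then obtain u where u: "\<forall>w\<in>Dm. u w = m w" "u w = c" "satisfies C u \<phi>" using \<phi>(2) by auto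
        let ?\<rho> = "\<lambda>v. if v \<in> ?F then u v else if v = w then c else m v"
        have "satisfies C ?\<rho> \<phi> = satisfies C u \<phi>"
          by (rule satisfies_cong) (use u in auto)
        then have "satisfies C ?\<rho> \<phi>" using u(3) by simp
        then show ?l unfolding satisfies_rename[OF \<psi>(1)] \<psi>(2) by (intro exI[of _ ?\<rho>]) simp
      qed
      ultimately show "\<exists>\<theta>. \<theta> \<in> formulas L ({()} <+> m ` Dm) \<and>
        (\<forall>c. satisfies C (case_sum (\<lambda>_. c) id) \<theta> \<longleftrightarrow>
          (\<exists>u. (\<forall>w\<in>Dm. u w = m w) \<and> u w = c \<and> (\<forall>\<phi>\<in>q. satisfies C u \<phi>)))"
        by (intro exI[of _ "rename ?h \<psi>"] conjI allI)
    qed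
    from bchoice[OF this] obtain th where th: "\<forall>q\<in>{q. finite q \<and> q \<subseteq> p}.
        th q \<in> formulas L ({()} <+> m ` Dm) \<and>
        (\<forall>c. satisfies C (case_sum (\<lambda>_. c) id) (th q) \<longleftrightarrow>
          (\<exists>u. (\<forall>w\<in>Dm. u w = m w) \<and> u w = c \<and> (\<forall>\<phi>\<in>q. satisfies C u \<phi>)))"
      by (elim exE)
    have "|m ` Dm| <o \<kappa>" by (intro small_image small_subset[OF W] DmW)
    note small = this
    have "th ` ?qs \<subseteq> formulas L ({()} <+> m ` Dm)" using th by auto
    note th_form = this
    have "\<forall>r. finite r \<and> r \<subseteq> th ` ?qs \<longrightarrow>
      (\<exists>c. \<forall>\<phi>\<in>r. satisfies C (case_sum (\<lambda>_. c) id) \<phi>)"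
    proof (intro allI impI)
      fix r assume r: "finite r \<and> r \<subseteq> th ` ?qs"
      obtain qs where qs: "qs \<subseteq> ?qs" "finite qs" "r = th ` qs"
        using finite_subset_image[of r th ?qs] r by blast
      have "finite (\<Union>qs)" "\<Union>qs \<subseteq> p" using qs(1,2) by auto
      from full[OF this] obtain u where u: "\<forall>w\<in>Dm. u w = m w" "\<forall>\<phi>\<in>\<Union>qs. satisfies C u \<phi>"
        by (elim exE conjE)
      have "satisfies C (case_sum (\<lambda>_. u w) id) (th q)" if "q \<in> qs" for q
      proof -
        have "q \<in> ?qs" using that qs(1) by blast
        with th have "satisfies C (case_sum (\<lambda>_. u w) id) (th q) \<longleftrightarrow>
          (\<exists>v. (\<forall>w\<in>Dm. v w = m w) \<and> v w = u w \<and> (\<forall>\<phi>\<in>q. satisfies C v \<phi>))"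
          by (simp only:)
        moreover have "\<forall>\<phi>\<in>q. satisfies C u \<phi>" using u(2) that by blast
        ultimately show ?thesis using u(1) by blast
      qed
      then show "\<exists>c. \<forall>\<phi>\<in>r. satisfies C (case_sum (\<lambda>_. c) id) \<phi>" using qs(3) by blast
    qed
    note th_fin = this
    obtain c where "\<forall>\<phi>\<in>th ` ?qs. satisfies C (case_sum (\<lambda>_. c) id) \<phi>"
      using saturatedD[OF small th_form th_fin] by (elim exE)
    note c_real = this
    have c: "\<exists>u. (\<forall>w\<in>Dm. u w = m w) \<and> u w = c \<and> (\<forall>\<phi>\<in>q. satisfies C u \<phi>)"
      if "finite q" "q \<subseteq> p" for q
    proof -
      have q: "q \<in> ?qs" using that by blast
      then have "satisfies C (case_sum (\<lambda>_. c) id) (th q)" by (intro bspec[OF c_real] imageI)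
      then show ?thesis using bspec[OF th q] by simp
    qed
    have "(w, c) \<in> M"
    proof (rule M_max[rule_format])
      fix F assume F: "finite F \<and> F \<subseteq> insert (w, c) M"
      show "Q F" unfolding Q_def
      proof (intro conjI allI impI)
        show "F \<subseteq> W \<times> UNIV" using F w \<open>M \<subseteq> W \<times> UNIV\<close> by blast
        fix q assume "finite q \<and> q \<subseteq> p"
        then have "\<exists>u. (\<forall>w\<in>Dm. u w = m w) \<and> u w = c \<and> (\<forall>\<phi>\<in>q. satisfies C u \<phi>)"
          by (intro c) auto
        then obtain u where u: "\<forall>w\<in>Dm. u w = m w" "u w = c" "\<forall>\<phi>\<in>q. satisfies C u \<phi>"
          by (elim exE conjE)
        have "u v = a" if "(v, a) \<in> F" for v a
        proof (cases "(v, a) \<in> M")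
          case True
          then have "v \<in> Dm" unfolding Dm_def by (rule image_eqI[rotated]) simp
          then show ?thesis using u(1) m[OF True] by simp
        next
          case False
          then show ?thesis using that F u(2) by auto
        qed
        then show "\<exists>u. (\<forall>(w, a)\<in>F. u w = a) \<and> (\<forall>\<phi>\<in>q. satisfies C u \<phi>)"
          using u(3) by blast
      qed
    qed
    then have "w \<in> Dm" unfolding Dm_def by (rule image_eqI[rotated]) simp
    then show False using \<open>w \<notin> Dm\<close> by blast
  qed
  then have "Dm = W" using DmW by auto
  show ?thesis
  proof (rule that)
    show "m w = g w" if "w \<in> D" for w
      by (rule m) (use M(1) that in blast)
    show "satisfies C m \<phi>" if \<phi>: "\<phi> \<in> p" for \<phi>
    proof -
      obtain u where u: "\<forall>w\<in>W. u w = m w" "satisfies C u \<phi>"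
        using full[of "{\<phi>}"] \<phi> \<open>Dm = W\<close> by auto
      have "satisfies C m \<phi> = satisfies C u \<phi>"
        by (rule satisfies_cong_on[OF subsetD[OF p \<phi>]]) (simp add: u(1))
      then show ?thesis using u(2) by simp
    qed
  qed
qed

lemma realize_type:
  assumes "|W| <o \<kappa>" "|A| <o \<kappa>" and p: "p \<subseteq> formulas L (W <+> A)"
    and "\<And>q. finite q \<Longrightarrow> q \<subseteq> p \<Longrightarrow> \<exists>u. \<forall>\<phi>\<in>q. satisfies C (case_sum u id) \<phi>"
  obtains u where "\<And>\<phi>. \<phi> \<in> p \<Longrightarrow> satisfies C (case_sum u id) \<phi>"
proof -
  have fin: "\<exists>v. (\<forall>w\<in>Inr ` A. v w = case_sum undefined id w) \<and> (\<forall>\<phi>\<in>q. satisfies C v \<phi>)"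
    if q: "finite q" "q \<subseteq> p" for q
  proof -
    obtain u where "\<forall>\<phi>\<in>q. satisfies C (case_sum u id) \<phi>" using assms(4) q by blast
    then show ?thesis by (intro exI[of _ "case_sum u id"]) auto
  qed
  have sub: "Inr ` A \<subseteq> W <+> A" by auto
  show ?thesis
  proof (rule realize_type_extending[OF small_Plus[OF assms(1,2)] p sub fin])
    fix v assume v: "\<And>w. w \<in> Inr ` A \<Longrightarrow> v w = case_sum undefined id w"
      "\<And>\<phi>. \<phi> \<in> p \<Longrightarrow> satisfies C v \<phi>"
    have "satisfies C (case_sum (v \<circ> Inl) id) \<phi>" if \<phi>: "\<phi> \<in> p" for \<phi>
    proof -
      have "satisfies C (case_sum (v \<circ> Inl) id) \<phi> = satisfies C v \<phi>"
        by (rule satisfies_cong_on[OF subsetD[OF p \<phi>]]) (use v(1) in auto)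
      then show ?thesis using v(2) \<phi> by blast
    qed
    then show thesis by (rule that)
  qed
qed

definition same_type :: "'m set \<Rightarrow> 'w set \<Rightarrow> ('w \<Rightarrow> 'm) \<Rightarrow> ('w \<Rightarrow> 'm) \<Rightarrow> bool" where
  "same_type A W u v \<longleftrightarrow> (\<forall>\<phi>\<in>formulas L (W <+> A).
    satisfies C (case_sum u id) \<phi> \<longleftrightarrow> satisfies C (case_sum v id) \<phi>)"

lemma same_type_aut:
  assumes "is_aut L C f" "\<And>a. a \<in> A \<Longrightarrow> f a = a"
  shows "same_type A W (f \<circ> u) u"
  unfolding same_type_def
proof
  fix \<phi> assume \<phi>: "\<phi> \<in> formulas L (W <+> A)"
  have "satisfies C (case_sum (f \<circ> u) id) \<phi> = satisfies C (f \<circ> case_sum u id) \<phi>"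
    by (rule satisfies_cong_on[OF \<phi>]) (use assms(2) in auto)
  then show "satisfies C (case_sum (f \<circ> u) id) \<phi> = satisfies C (case_sum u id) \<phi>"
    using satisfies_aut[OF assms(1) \<phi> univ_C] by simp
qed

text \<open>Strong homogeneity speaks about an elementary map on a set; by equality of types the entries
  \<open>u w\<close> and \<open>u w'\<close> coincide only if \<open>v w\<close> and \<open>v w'\<close> do, so that \<open>u w \<mapsto> v w\<close> is such a map.\<close>

lemma homogeneous_tuples:
  fixes u v :: "'w \<Rightarrow> 'm"
  assumes "|W| <o \<kappa>" "|A| <o \<kappa>" and same: "same_type A W u v"
  obtains f where "is_aut L C f" "\<And>a. a \<in> A \<Longrightarrow> f a = a" "\<And>w. w \<in> W \<Longrightarrow> f (u w) = v w"
proof -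
  let ?U = "case_sum u id" and ?V = "case_sum v id" and ?I = "W <+> A"
  let ?h = "inv_into ?I ?U"
  have same': "satisfies C ?U \<phi> \<longleftrightarrow> satisfies C ?V \<phi>" if "\<phi> \<in> formulas L ?I" for \<phi>
    using same that unfolding same_type_def by blast
  have h: "?h x \<in> ?I" "?U (?h x) = x" if "x \<in> ?U ` ?I" for x
    by (rule inv_into_into[OF that], rule f_inv_into_f[OF that])
  have elementary: "\<forall>\<phi>\<in>formulas L (?U ` ?I). satisfies C (?V \<circ> ?h) \<phi> \<longleftrightarrow> satisfies C id \<phi>"
  proof
    fix \<phi> assume \<phi>: "\<phi> \<in> formulas L (?U ` ?I)"
    have "satisfies C (?V \<circ> ?h) \<phi> \<longleftrightarrow> satisfies C ?V (rename ?h \<phi>)"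
      by (rule satisfies_rename[OF \<phi>, symmetric])
    also have "\<dots> \<longleftrightarrow> satisfies C ?U (rename ?h \<phi>)"
      by (rule same'[OF rename_in_formulas[OF \<phi> h(1)], symmetric])
    also have "\<dots> \<longleftrightarrow> satisfies C (?U \<circ> ?h) \<phi>"
      by (rule satisfies_rename[OF \<phi>])
    also have "\<dots> \<longleftrightarrow> satisfies C id \<phi>"
      by (rule satisfies_cong_on[OF \<phi>]) (simp only: comp_apply h id_apply)
    finally show "satisfies C (?V \<circ> ?h) \<phi> \<longleftrightarrow> satisfies C id \<phi>" .
  qed
  have "|?U ` ?I| <o \<kappa>" by (intro small_image small_Plus assms)
  from strongly_homogeneousD[OF this elementary]
  obtain f where f: "is_aut L C f" "\<forall>x\<in>?U ` ?I. f x = (?V \<circ> ?h) x"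
    by (elim exE conjE)
  have fV: "f (?U w) = ?V w" if w: "w \<in> ?I" for w
  proof -
    have hw: "?h (?U w) \<in> ?I" "?U (?h (?U w)) = ?U w" by (rule h; use w in blast)+
    let ?eq = "Equal (FVar (?h (?U w))) (FVar w) :: ('f, 'r, 'w + 'm) fm"
    have "?eq \<in> formulas L ?I" using hw(1) w by (simp add: formulas_def)
    then have "?V (?h (?U w)) = ?V w" using same'[of ?eq] hw(2) by (simp add: satisfies_def)
    moreover have "f (?U w) = ?V (?h (?U w))" using f(2) w by (simp only: comp_apply imageI)
    ultimately show ?thesis by simp
  qed
  show ?thesis
  proof (rule that[OF f(1)])
    show "f a = a" if "a \<in> A" for a using fV[of "Inr a"] that by auto
    show "f (u w) = v w" if "w \<in> W" for w using fV[of "Inl w"] that by auto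
  qed
qed

end

section \<open>Coheirs\<close>

context monster
begin

text \<open>A formula mentions finitely many entries of the tuple, and these can be renumbered by natural
  numbers.\<close>

lemma type_over_relatively_closed_finitely_satisfiable:
  fixes c :: "'i \<Rightarrow> 'j \<Rightarrow> 'm"
  assumes B: "relatively_closed L C J S B" and c: "c ` K \<subseteq> S"
    and \<phi>: "\<phi> \<in> formulas L (K \<times> J <+> coords J B)"
    and sat: "satisfies C (case_sum (case_prod c) id) \<phi>"
  shows "\<exists>s. s ` K \<subseteq> B \<and> satisfies C (case_sum (case_prod s) id) \<phi>"
proof (cases "K = {}")
  case True
  then show ?thesis using sat by (intro exI[of _ c]) auto
next
  case False
  then obtain k0 where k0: "k0 \<in> K" by blast
  let ?F = "{k. \<exists>j. Inl (k, j) \<in> fm_vars \<phi>}"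
  have "?F \<subseteq> (\<lambda>v. fst (projl v)) ` fm_vars \<phi>" by force
  then have fin: "finite ?F" using finite_fm_vars finite_surj by blast
  have FK: "?F \<subseteq> K" using \<phi> by (auto simp: formulas_def)
  let ?ix = "to_nat_on ?F"
  have inj: "inj_on ?ix ?F" using inj_on_to_nat_on[OF countable_finite[OF fin]] .
  let ?h = "map_sum (\<lambda>(k, j). (?ix k, j)) id"
  have \<psi>: "rename ?h \<phi> \<in> formulas L ((UNIV :: nat set) \<times> J <+> coords J B)"
    by (rule rename_in_formulas[OF \<phi>]) auto
  \<comment> \<open>Positions that no variable of \<open>\<phi>\<close> uses are filled with an arbitrary entry of \<open>c\<close>.\<close>
  let ?s = "\<lambda>n. if n \<in> ?ix ` ?F then c (inv_into ?F ?ix n) else c k0"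
  have "satisfies C (case_sum (case_prod ?s) id) (rename ?h \<phi>)"
  proof -
    have "satisfies C (case_sum (case_prod ?s) id \<circ> ?h) \<phi> = satisfies C (case_sum (case_prod c) id) \<phi>"
    proof (rule satisfies_cong)
      fix v assume v: "v \<in> fm_vars \<phi>"
      show "(case_sum (case_prod ?s) id \<circ> ?h) v = case_sum (case_prod c) id v"
      proof (cases v)
        case (Inl kj)
        then obtain k j where kj: "v = Inl (k, j)" by (cases kj) auto
        then have "k \<in> ?F" using v by blast
        then show ?thesis using kj inj by (simp add: inv_into_f_f)
      qed auto
    qed
    then show ?thesis using sat by (simp only: satisfies_rename[OF \<phi>])
  qed
  moreover have "range ?s \<subseteq> S"
  proof (intro subsetI, elim rangeE)
    fix x n assume "x = ?s n"
    moreover have "inv_into ?F ?ix n \<in> K" if "n \<in> ?ix ` ?F" using inv_into_into[OF that] FK by blast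
    ultimately show "x \<in> S" using c k0 by (auto split: if_splits)
  qed
  ultimately have "\<exists>s. range s \<subseteq> S \<and> satisfies C (case_sum (case_prod s) id) (rename ?h \<phi>)"
    by (intro exI[of _ ?s] conjI)
  with B \<psi> have "\<exists>s. range s \<subseteq> B \<and> satisfies C (case_sum (case_prod s) id) (rename ?h \<phi>)"
    by (simp only: relatively_closed_def)
  then obtain s where s: "range s \<subseteq> B" "satisfies C (case_sum (case_prod s) id) (rename ?h \<phi>)"
    by (elim exE conjE)
  have "satisfies C (case_sum (case_prod (s \<circ> ?ix)) id) \<phi>
      = satisfies C (case_sum (case_prod s) id \<circ> ?h) \<phi>"
    by (rule satisfies_cong) (auto split: sum.splits)
  then have "satisfies C (case_sum (case_prod (s \<circ> ?ix)) id) \<phi>"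
    using s(2) by (simp only: satisfies_rename[OF \<phi>])
  moreover have "(s \<circ> ?ix) ` K \<subseteq> B" using s(1) by auto
  ultimately show ?thesis by (intro exI[of _ "s \<circ> ?ix"] conjI)
qed

definition fin_sat_in :: "'i set \<Rightarrow> ('j \<Rightarrow> 'm) set \<Rightarrow> ('f, 'r, 'i \<times> 'j + 'm) fm set \<Rightarrow> bool" where
  "fin_sat_in K B F \<longleftrightarrow> (\<exists>s. s ` K \<subseteq> B \<and> (\<forall>\<phi>\<in>F. satisfies C (case_sum (case_prod s) id) \<phi>))"

text \<open>A complete type over the whole universe that is finitely satisfiable in tuples with entries
  from \<open>B\<close>; that is, a global coheir of
  its restriction to \<open>coords J B\<close>.\<close>

definition coheir :: "'i set \<Rightarrow> 'j set \<Rightarrow> ('j \<Rightarrow> 'm) set \<Rightarrow> ('f, 'r, 'i \<times> 'j + 'm) fm set \<Rightarrow> bool" where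
  "coheir K J B P \<longleftrightarrow> P \<subseteq> formulas L (K \<times> J <+> UNIV) \<and>
    (\<forall>F. finite F \<and> F \<subseteq> P \<longrightarrow> fin_sat_in K B F) \<and>
    (\<forall>\<phi>\<in>formulas L (K \<times> J <+> UNIV). \<phi> \<in> P \<or> Neg \<phi> \<in> P)"

lemma coheir_Neg:
  assumes "coheir K J B P" "\<phi> \<in> formulas L (K \<times> J <+> UNIV)"
  shows "Neg \<phi> \<in> P \<longleftrightarrow> \<phi> \<notin> P"
proof -
  have "\<not> (\<phi> \<in> P \<and> Neg \<phi> \<in> P)"
  proof
    assume "\<phi> \<in> P \<and> Neg \<phi> \<in> P"
    then have "fin_sat_in K B {\<phi>, Neg \<phi>}" using assms(1) by (simp add: coheir_def)
    then show False by (auto simp: fin_sat_in_def)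
  qed
  then show ?thesis using assms unfolding coheir_def by blast
qed

text \<open>Maximality makes the type complete: a tuple from \<open>B\<close> that satisfies the remaining formulas of
  two finite sets refuting \<open>\<phi>\<close> and \<open>Neg \<phi>\<close> satisfies one of these two.\<close>

lemma exists_coheir:
  fixes c :: "'i \<Rightarrow> 'j \<Rightarrow> 'm"
  assumes B: "relatively_closed L C J S B" and c: "c ` K \<subseteq> S"
  obtains P where "coheir K J B P"
    "\<And>\<phi>. \<phi> \<in> formulas L (K \<times> J <+> coords J B) \<Longrightarrow> satisfies C (case_sum (case_prod c) id) \<phi> \<Longrightarrow> \<phi> \<in> P"
proof -
  let ?V = "K \<times> J <+> (UNIV :: 'm set)"
  let ?T = "{\<phi> \<in> formulas L (K \<times> J <+> coords J B). satisfies C (case_sum (case_prod c) id) \<phi>}"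
  define Q where "Q F \<longleftrightarrow> F \<subseteq> formulas L ?V \<and> fin_sat_in K B F" for F
  have "formulas L (K \<times> J <+> coords J B) \<subseteq> formulas L ?V" by (rule formulas_mono) auto
  then have T: "?T \<subseteq> formulas L ?V" by blast
  have "\<forall>F. finite F \<and> F \<subseteq> ?T \<longrightarrow> Q F"
  proof (intro allI impI)
    fix F assume F: "finite F \<and> F \<subseteq> ?T"
    then have "finite F" "F \<subseteq> formulas L (K \<times> J <+> coords J B)" by auto
    then obtain \<phi> where \<phi>: "\<phi> \<in> formulas L (K \<times> J <+> coords J B)"
      "\<And>\<rho>. satisfies C \<rho> \<phi> \<longleftrightarrow> (\<forall>\<psi>\<in>F. satisfies C \<rho> \<psi>)"
      by (rule conjunction_formula[where S = C]) (rule that)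
    have "satisfies C (case_sum (case_prod c) id) \<phi>" using F \<phi>(2) by auto
    from type_over_relatively_closed_finitely_satisfiable[OF B c \<phi>(1) this]
    have "fin_sat_in K B F" by (simp only: fin_sat_in_def \<phi>(2))
    then show "Q F" using F T by (auto simp: Q_def)
  qed
  from maximal_of_finite_character[OF this]
  obtain P where P: "?T \<subseteq> P" "\<forall>F. finite F \<and> F \<subseteq> P \<longrightarrow> Q F"
    and P_max: "\<forall>x. (\<forall>F. finite F \<and> F \<subseteq> insert x P \<longrightarrow> Q F) \<longrightarrow> x \<in> P"
    by (elim exE conjE)
  have "\<phi> \<in> P \<or> Neg \<phi> \<in> P" if \<phi>: "\<phi> \<in> formulas L ?V" for \<phi>
  proof (rule ccontr)
    assume neg: "\<not> (\<phi> \<in> P \<or> Neg \<phi> \<in> P)"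
    then have "\<not> (\<forall>F. finite F \<and> F \<subseteq> insert \<phi> P \<longrightarrow> Q F)" using spec[OF P_max, of \<phi>] by blast
    then obtain F1 where F1: "finite F1" "F1 \<subseteq> insert \<phi> P" "\<not> Q F1" by blast
    have "\<not> (\<forall>F. finite F \<and> F \<subseteq> insert (Neg \<phi>) P \<longrightarrow> Q F)"
      using spec[OF P_max, of "Neg \<phi>"] neg by blast
    then obtain F2 where F2: "finite F2" "F2 \<subseteq> insert (Neg \<phi>) P" "\<not> Q F2" by blast
    let ?F = "(F1 \<union> F2) - {\<phi>, Neg \<phi>}"
    have "finite ?F \<and> ?F \<subseteq> P" using F1 F2 by blast
    then have QF: "Q ?F" by (rule P(2)[THEN spec, THEN mp])
    then have "\<exists>s. s ` K \<subseteq> B \<and> (\<forall>\<psi>\<in>?F. satisfies C (case_sum (case_prod s) id) \<psi>)"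
      by (simp only: Q_def fin_sat_in_def)
    then obtain s where s: "s ` K \<subseteq> B" "\<forall>\<psi>\<in>?F. satisfies C (case_sum (case_prod s) id) \<psi>"
      by (elim exE conjE)
    have form: "F1 \<subseteq> formulas L ?V" "F2 \<subseteq> formulas L ?V"
      using QF F1(2) F2(2) neg \<phi> unfolding Q_def by auto
    show False
    proof (cases "satisfies C (case_sum (case_prod s) id) \<phi>")
      case True
      then have "\<forall>\<psi>\<in>F1. satisfies C (case_sum (case_prod s) id) \<psi>" using s(2) F1(2) neg by auto
      then have "Q F1" unfolding Q_def fin_sat_in_def
        using form(1) s(1) by (intro conjI exI[of _ s])
      with F1(3) show False by simp
    next
      case False
      then have "\<forall>\<psi>\<in>F2. satisfies C (case_sum (case_prod s) id) \<psi>" using s(2) F2(2) neg by auto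
      then have "Q F2" unfolding Q_def fin_sat_in_def
        using form(2) s(1) by (intro conjI exI[of _ s])
      with F2(3) show False by simp
    qed
  qed
  moreover have "P \<subseteq> formulas L ?V"
  proof
    fix \<phi> assume "\<phi> \<in> P"
    then have "Q {\<phi>}" using P(2) by simp
    then show "\<phi> \<in> formulas L ?V" by (simp add: Q_def)
  qed
  moreover have "\<forall>F. finite F \<and> F \<subseteq> P \<longrightarrow> fin_sat_in K B F" using P(2) by (simp add: Q_def)
  ultimately have "coheir K J B P" by (simp add: coheir_def)
  then show ?thesis by (rule that) (use P(1) in auto)
qed

definition realizes_over ::
  "'i set \<Rightarrow> 'j set \<Rightarrow> ('f, 'r, 'i \<times> 'j + 'm) fm set \<Rightarrow> 'm set \<Rightarrow> ('i \<times> 'j \<Rightarrow> 'm) \<Rightarrow> bool" where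
  "realizes_over K J P E d \<longleftrightarrow>
    (\<forall>\<phi>\<in>formulas L (K \<times> J <+> E). satisfies C (case_sum d id) \<phi> \<longleftrightarrow> \<phi> \<in> P)"

lemma realizes_over_mono:
  "realizes_over K J P E d \<Longrightarrow> E' \<subseteq> E \<Longrightarrow> realizes_over K J P E' d"
  unfolding realizes_over_def using formulas_mono[of "K \<times> J <+> E'" "K \<times> J <+> E" L] by blast

lemma realizes_over_same_type:
  "realizes_over K J P E d \<Longrightarrow> realizes_over K J P E d' \<Longrightarrow> same_type E (K \<times> J) d d'"
  unfolding realizes_over_def same_type_def by blast

lemma realizes_overI:
  assumes P: "coheir K J B P"
    and d: "\<And>\<phi>. \<phi> \<in> P \<inter> formulas L (K \<times> J <+> E) \<Longrightarrow> satisfies C (case_sum d id) \<phi>"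
  shows "realizes_over K J P E d"
  unfolding realizes_over_def
proof
  fix \<phi> assume \<phi>: "\<phi> \<in> formulas L (K \<times> J <+> E)"
  have "\<phi> \<in> formulas L (K \<times> J <+> UNIV)"
    using \<phi> formulas_mono[of "K \<times> J <+> E" "K \<times> J <+> UNIV" L] by blast
  from coheir_Neg[OF P this] show "satisfies C (case_sum d id) \<phi> \<longleftrightarrow> \<phi> \<in> P"
    using d[of \<phi>] d[of "Neg \<phi>"] \<phi> by auto
qed

lemma exists_realizes_over:
  fixes P :: "('f, 'r, 'i \<times> 'j + 'm) fm set"
  assumes P: "coheir K J B P" and small: "|K| <o \<kappa>" "|J| <o \<kappa>" "|E| <o \<kappa>"
  obtains d where "realizes_over K J P E d"
proof (rule realize_type[OF small_Times[OF small(1,2)] small(3)])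
  show "P \<inter> formulas L (K \<times> J <+> E) \<subseteq> formulas L (K \<times> J <+> E)" by blast
next
  fix q assume "finite q" "q \<subseteq> P \<inter> formulas L (K \<times> J <+> E)"
  then have "fin_sat_in K B q" using P by (simp add: coheir_def)
  then show "\<exists>u. \<forall>\<phi>\<in>q. satisfies C (case_sum u id) \<phi>" by (auto simp: fin_sat_in_def)
next
  fix d assume "\<And>\<phi>. \<phi> \<in> P \<inter> formulas L (K \<times> J <+> E) \<Longrightarrow> satisfies C (case_sum d id) \<phi>"
  then have "realizes_over K J P E d" by (rule realizes_overI[OF P])
  then show thesis by (rule that)
qed

text \<open>In a formula whose variables are summands \<open>'x + 'w\<close>, the slots \<open>'w\<close> are filled with the
  parameters \<open>u\<close>.\<close>

definition plug :: "('w \<Rightarrow> 'm) \<Rightarrow> ('x + 'w) + 'm \<Rightarrow> 'x + 'm" where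
  "plug u = case_sum (map_sum id u) Inr"

text \<open>Membership in a coheir depends only on the type over \<open>B\<close> of the parameters: a formula that
  separates \<open>u\<close> from \<open>v\<close> inside \<open>P\<close> would do so at a tuple from \<open>B\<close>.\<close>

lemma coheir_invariant:
  fixes u v :: "'w \<Rightarrow> 'm"
  assumes P: "coheir K J B P" and same: "same_type (coords J B) W u v"
    and \<phi>: "\<phi> \<in> formulas L ((K \<times> J <+> W) <+> coords J B)"
    and u: "rename (plug u) \<phi> \<in> P"
  shows "rename (plug v) \<phi> \<in> P"
proof (rule ccontr)
  have form: "rename (plug w) \<phi> \<in> formulas L (K \<times> J <+> UNIV)" for w
    by (rule rename_in_formulas[OF \<phi>]) (auto simp: plug_def)
  assume "rename (plug v) \<phi> \<notin> P"
  then have "Neg (rename (plug v) \<phi>) \<in> P" using coheir_Neg[OF P form] by blast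
  with u have "fin_sat_in K B {rename (plug u) \<phi>, Neg (rename (plug v) \<phi>)}"
    using P by (simp add: coheir_def)
  then obtain s where s: "s ` K \<subseteq> B" "satisfies C (case_sum (case_prod s) id) (rename (plug u) \<phi>)"
    "\<not> satisfies C (case_sum (case_prod s) id) (rename (plug v) \<phi>)"
    by (auto simp: fin_sat_in_def)
  let ?h = "case_sum (case_sum (\<lambda>x. Inr (case_prod s x)) Inl) Inr"
  have \<psi>: "rename ?h \<phi> \<in> formulas L (W <+> coords J B)"
    by (rule rename_in_formulas[OF \<phi>]) (use s(1) in \<open>auto simp: image_subset_iff intro!: coordsI\<close>)
  have sat: "satisfies C (case_sum w id) (rename ?h \<phi>) \<longleftrightarrow>
      satisfies C (case_sum (case_prod s) id) (rename (plug w) \<phi>)" for w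
    unfolding satisfies_rename[OF \<phi>]
    by (rule satisfies_cong) (auto simp: plug_def split: sum.splits)
  show False using same \<psi> s(2,3) unfolding same_type_def sat[symmetric] by blast
qed

section \<open>Realizations of a coheir have the same Lascar strong type\<close>

text \<open>Let \<open>d1\<close> realize \<open>P\<close> over a model \<open>M\<close> containing \<open>B\<close>, and let \<open>d2\<close> realize \<open>P\<close> over \<open>M\<close> and
  \<open>d1\<close>; then \<open>d1\<close> and \<open>d2\<close> are conjugate over \<open>M\<close>.  Since \<open>u\<close> and \<open>d1\<close> have the same type over \<open>B\<close>,
  invariance of \<open>P\<close> gives the pairs \<open>(d1, d2)\<close> and \<open>(u, d)\<close> the same type over \<open>B\<close>.  So some
  automorphism \<open>g\<close> fixing \<open>B\<close> maps one pair to the other, and \<open>u\<close> and \<open>d\<close> are conjugate over the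
  model \<open>g ` M\<close>.\<close>

lemma coheir_realizations_conjugate_over_model:
  fixes u d :: "'i \<times> 'j \<Rightarrow> 'm"
  assumes P: "coheir K J B P" and small: "|K| <o \<kappa>" "|J| <o \<kappa>" "|B| <o \<kappa>"
    and u: "realizes_over K J P (coords J B) u"
    and d: "realizes_over K J P (coords J B \<union> u ` (K \<times> J)) d"
  obtains M f where "coords J B \<subseteq> M" "small_model \<kappa> L C M" "is_aut L C f"
    "\<And>a. a \<in> M \<Longrightarrow> f a = a" "\<And>x. x \<in> K \<times> J \<Longrightarrow> f (u x) = d x"
proof -
  let ?D = "coords J B" and ?W = "K \<times> J"
  have D: "|?D| <o \<kappa>" by (intro small_coords small)
  have W: "|?W| <o \<kappa>" by (intro small_Times small)
  obtain M where M: "?D \<subseteq> M" "small_model \<kappa> L C M"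
    by (rule exists_small_model[OF D]) (rule that)
  have M_small: "|M| <o \<kappa>" using M(2) by (simp add: small_model_def)
  obtain d1 where d1: "realizes_over K J P M d1"
    by (rule exists_realizes_over[OF P small(1,2) M_small]) (rule that)
  have "|M \<union> d1 ` ?W| <o \<kappa>" by (intro small_Un small_image M_small W)
  then obtain d2 where d2: "realizes_over K J P (M \<union> d1 ` ?W) d2"
    by (rule exists_realizes_over[OF P small(1,2)]) (rule that)
  have d1_D: "realizes_over K J P ?D d1" using realizes_over_mono[OF d1 M(1)] .
  have u_d1: "same_type ?D ?W u d1" by (rule realizes_over_same_type[OF u d1_D])
  have "same_type ?D (?W <+> ?W) (case_sum d2 d1) (case_sum d u)"
    unfolding same_type_def
  proof
    fix \<phi> :: "('f, 'r, ('i \<times> 'j + 'i \<times> 'j) + 'm) fm"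
    assume \<phi>: "\<phi> \<in> formulas L ((?W <+> ?W) <+> ?D)"
    have sat: "satisfies C (case_sum (case_sum y x) id) \<phi> \<longleftrightarrow> rename (plug x) \<phi> \<in> P"
      if y: "realizes_over K J P (?D \<union> x ` ?W) y" for x y
    proof -
      have "rename (plug x) \<phi> \<in> formulas L (?W <+> (?D \<union> x ` ?W))"
        by (rule rename_in_formulas[OF \<phi>]) (auto simp: plug_def)
      with y have "rename (plug x) \<phi> \<in> P \<longleftrightarrow> satisfies C (case_sum y id) (rename (plug x) \<phi>)"
        unfolding realizes_over_def by blast
      also have "\<dots> \<longleftrightarrow> satisfies C (case_sum (case_sum y x) id) \<phi>"
        unfolding satisfies_rename[OF \<phi>]
        by (rule satisfies_cong) (auto simp: plug_def split: sum.splits)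
      finally show ?thesis by blast
    qed
    have "realizes_over K J P (?D \<union> d1 ` ?W) d2" by (rule realizes_over_mono[OF d2]) (use M(1) in blast)
    from sat[OF this] sat[OF d] show "satisfies C (case_sum (case_sum d2 d1) id) \<phi> \<longleftrightarrow>
        satisfies C (case_sum (case_sum d u) id) \<phi>"
      using coheir_invariant[OF P u_d1 \<phi>]
        coheir_invariant[OF P realizes_over_same_type[OF d1_D u] \<phi>] by blast
  qed
  then obtain g where g: "is_aut L C g" "\<And>a. a \<in> ?D \<Longrightarrow> g a = a"
    "\<And>x. x \<in> ?W <+> ?W \<Longrightarrow> g (case_sum d2 d1 x) = case_sum d u x"
    by (rule homogeneous_tuples[OF small_Plus[OF W W] D]) (rule that)
  have "same_type M ?W d1 d2"
    by (rule realizes_over_same_type[OF d1]) (rule realizes_over_mono[OF d2], blast)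
  then obtain k where k: "is_aut L C k" "\<And>a. a \<in> M \<Longrightarrow> k a = a"
    "\<And>x. x \<in> ?W \<Longrightarrow> k (d1 x) = d2 x"
    by (rule homogeneous_tuples[OF W M_small]) (rule that)
  let ?g' = "inv_into UNIV g"
  have bij: "bij g" using g(1) by (simp add: is_aut_def)
  then have g': "?g' (g x) = x" for x by (simp add: bij_is_inj)
  have u: "g (d1 x) = u x" and d: "g (d2 x) = d x" if "x \<in> ?W" for x
    using g(3)[of "Inr x"] g(3)[of "Inl x"] that by auto
  show ?thesis
  proof (rule that)
    show "?D \<subseteq> g ` M"
    proof
      fix a assume "a \<in> ?D"
      then show "a \<in> g ` M" using g(2) M(1) by (intro image_eqI[of _ g a]) auto
    qed
    show "small_model \<kappa> L C (g ` M)" by (rule small_model_aut[OF g(1) M(2)])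
    show "is_aut L C (g \<circ> k \<circ> ?g')" by (intro is_aut_comp is_aut_inv g k)
    show "(g \<circ> k \<circ> ?g') a = a" if "a \<in> g ` M" for a using that k(2) by (auto simp: g')
    show "(g \<circ> k \<circ> ?g') (u x) = d x" if "x \<in> ?W" for x
      using that k(3) by (simp add: g' flip: u d)
  qed
qed

text \<open>The tuples \<open>c\<close> and \<open>f(c)\<close> have the same type over \<open>B\<close>, so one coheir is realized over \<open>B\<close> by
  both.  Each of them is conjugate over a small model to a realization \<open>d\<close> of this coheir over
  \<open>B\<close>, \<open>c\<close> and \<open>f(c)\<close>.\<close>

lemma aut_over_relatively_closed_Lascar:
  fixes c :: "'i \<Rightarrow> 'j \<Rightarrow> 'm"
  assumes B: "relatively_closed L C J S B" and small: "|K| <o \<kappa>" "|J| <o \<kappa>" "|B| <o \<kappa>"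
    and c: "c ` K \<subseteq> S" and f: "is_aut L C f" "\<And>a. a \<in> coords J B \<Longrightarrow> f a = a"
  obtains M1 f1 M2 f2 where
    "coords J B \<subseteq> M1" "small_model \<kappa> L C M1" "is_aut L C f1" "\<And>a. a \<in> M1 \<Longrightarrow> f1 a = a"
    "coords J B \<subseteq> M2" "small_model \<kappa> L C M2" "is_aut L C f2" "\<And>a. a \<in> M2 \<Longrightarrow> f2 a = a"
    "\<And>k j. k \<in> K \<Longrightarrow> j \<in> J \<Longrightarrow> f1 (c k j) = f2 (f (c k j))"
proof -
  let ?D = "coords J B" and ?W = "K \<times> J"
  obtain P where P: "coheir K J B P" and cP: "\<And>\<phi>. \<phi> \<in> formulas L (?W <+> ?D) \<Longrightarrow>
      satisfies C (case_sum (case_prod c) id) \<phi> \<Longrightarrow> \<phi> \<in> P"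
    by (rule exists_coheir[OF B c]) (rule that)
  let ?u = "case_prod c"
  have u: "realizes_over K J P ?D ?u"
    unfolding realizes_over_def
  proof
    fix \<phi> assume \<phi>: "\<phi> \<in> formulas L (?W <+> ?D)"
    then have "\<phi> \<in> formulas L (?W <+> UNIV)"
      using formulas_mono[of "?W <+> ?D" "?W <+> UNIV" L] by blast
    from coheir_Neg[OF P this] show "satisfies C (case_sum ?u id) \<phi> \<longleftrightarrow> \<phi> \<in> P"
      using cP[OF \<phi>] cP[of "Neg \<phi>"] \<phi> by auto
  qed
  have "same_type ?D ?W (f \<circ> ?u) ?u" by (rule same_type_aut[OF f])
  with u have fu: "realizes_over K J P ?D (f \<circ> ?u)"
    unfolding realizes_over_def same_type_def by blast
  let ?E = "?D \<union> ?u ` ?W \<union> (f \<circ> ?u) ` ?W"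
  have "|?E| <o \<kappa>" by (intro small_Un small_image small_coords small_Times small)
  then obtain d where d: "realizes_over K J P ?E d"
    by (rule exists_realizes_over[OF P small(1,2)]) (rule that)
  have d1: "realizes_over K J P (?D \<union> ?u ` ?W) d" by (rule realizes_over_mono[OF d]) blast
  have d2: "realizes_over K J P (?D \<union> (f \<circ> ?u) ` ?W) d" by (rule realizes_over_mono[OF d]) blast
  obtain M1 f1 where 1: "?D \<subseteq> M1" "small_model \<kappa> L C M1" "is_aut L C f1"
    "\<And>a. a \<in> M1 \<Longrightarrow> f1 a = a" "\<And>x. x \<in> ?W \<Longrightarrow> f1 (?u x) = d x"
    by (rule coheir_realizations_conjugate_over_model[OF P small u d1]) (rule that)
  obtain M2 f2 where 2: "?D \<subseteq> M2" "small_model \<kappa> L C M2" "is_aut L C f2"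
    "\<And>a. a \<in> M2 \<Longrightarrow> f2 a = a" "\<And>x. x \<in> ?W \<Longrightarrow> f2 ((f \<circ> ?u) x) = d x"
    by (rule coheir_realizations_conjugate_over_model[OF P small fu d2]) (rule that)
  have eq: "f1 (c k j) = f2 (f (c k j))" if "k \<in> K" "j \<in> J" for k j
    using 1(5)[of "(k, j)"] 2(5)[of "(k, j)"] that by simp
  show ?thesis by (rule that[of M1 f1 M2 f2]) (fact 1 2 eq)+
qed

end

section \<open>The groups of automorphisms\<close>

lemma compose_comp: "compose I (f \<circ> g) a = compose I f (compose I g a)"
  by (auto simp: compose_def)

lemma compose_comp_image: "compose I (f \<circ> g) ` A = compose I f ` compose I g ` A"
  by (simp only: image_image compose_comp[symmetric])

lemma orbit_equiv_cong:
  assumes "orbit_equiv H W c d" "\<And>w. w \<in> W \<Longrightarrow> d w = d' w"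
  shows "orbit_equiv H W c d'"
  using assms by (auto simp: orbit_equiv_def)

text \<open>Tuples indexed by \<open>I\<close> are extensional functions, so \<open>compose I id\<close> fixes them.\<close>

locale monster_hyperimaginary = monster \<kappa> L T C
  for \<kappa> :: "'k rel" and L :: "('f, 'r) language" and T :: "('f, 'r, nat) fm set"
    and C :: "('f, 'r, 'm) struct" +
  fixes I :: "'k set" and e :: "('k \<Rightarrow> 'm) set"
  assumes e: "e \<subseteq> extensional I"
begin

abbreviation Aut_e :: "('m \<Rightarrow> 'm) monoid" where
  "Aut_e \<equiv> Aut_hyp L C I e"

abbreviation Lascar_group :: "('m \<Rightarrow> 'm) set" where
  "Lascar_group \<equiv> Autf_L \<kappa> L C I e"

lemma Aut_e_carrier: "f \<in> carrier Aut_e \<longleftrightarrow> is_aut L C f \<and> fixes_hyp I e f"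
  by (simp add: Aut_hyp_def)

lemma Aut_e_mult [simp]: "f \<otimes>\<^bsub>Aut_e\<^esub> g = f \<circ> g"
  by (simp add: Aut_hyp_def)

lemma Aut_e_one [simp]: "\<one>\<^bsub>Aut_e\<^esub> = id"
  by (simp add: Aut_hyp_def)

lemma Aut_e_bij: "f \<in> carrier Aut_e \<Longrightarrow> bij f"
  by (simp add: Aut_e_carrier is_aut_def)

lemma inv_comp_self: "f \<in> carrier Aut_e \<Longrightarrow> inv_into UNIV f \<circ> f = id"
  using Aut_e_bij bij_is_inj inv_o_cancel by blast

lemma comp_inv_self: "f \<in> carrier Aut_e \<Longrightarrow> f \<circ> inv_into UNIV f = id"
  using Aut_e_bij by (auto simp: fun_eq_iff bij_is_surj surj_f_inv_f)

lemma compose_id: "compose I id ` e = e"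
proof -
  have "compose I id a = a" if "a \<in> e" for a
    using that e by (auto simp: compose_def fun_eq_iff extensional_def)
  then show ?thesis by (simp cong: image_cong)
qed

lemma comp_closed: "f \<in> carrier Aut_e \<Longrightarrow> g \<in> carrier Aut_e \<Longrightarrow> f \<circ> g \<in> carrier Aut_e"
  by (simp add: Aut_e_carrier is_aut_comp fixes_hyp_def compose_comp_image)

lemma inv_closed:
  assumes "f \<in> carrier Aut_e"
  shows "inv_into UNIV f \<in> carrier Aut_e"
proof -
  have "compose I (inv_into UNIV f) ` e = compose I (inv_into UNIV f) ` compose I f ` e"
    using assms by (simp add: Aut_e_carrier fixes_hyp_def)
  also have "\<dots> = compose I (inv_into UNIV f \<circ> f) ` e"
    by (simp only: compose_comp_image)
  also have "\<dots> = e" by (simp only: inv_comp_self[OF assms] compose_id)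
  finally show ?thesis using assms by (simp add: Aut_e_carrier fixes_hyp_def is_aut_inv)
qed

lemma group_Aut_e: "group Aut_e"
proof (rule groupI)
  show "\<one>\<^bsub>Aut_e\<^esub> \<in> carrier Aut_e"
    using compose_id by (simp add: Aut_e_carrier fixes_hyp_def is_aut_id)
  show "\<exists>g\<in>carrier Aut_e. g \<otimes>\<^bsub>Aut_e\<^esub> f = \<one>\<^bsub>Aut_e\<^esub>" if "f \<in> carrier Aut_e" for f
    using inv_closed[OF that] inv_comp_self[OF that] by auto
qed (auto simp: comp_closed comp_assoc)

lemma m_inv_Aut_e: "f \<in> carrier Aut_e \<Longrightarrow> inv\<^bsub>Aut_e\<^esub> f = inv_into UNIV f"
  by (rule group.inv_equality[OF group_Aut_e]) (simp_all add: inv_comp_self inv_closed)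

definition Lascar_generators :: "('m \<Rightarrow> 'm) set" where
  "Lascar_generators = {f \<in> carrier Aut_e.
    \<exists>M. small_model \<kappa> L C M \<and> hyp_in_dcl L C I e M \<and> (\<forall>m\<in>M. f m = m)}"

lemma Lascar_group_eq: "Lascar_group = generate Aut_e Lascar_generators"
  by (simp add: Autf_L_def Lascar_generators_def)

lemma Lascar_generatorsI:
  assumes "hyp_in_dcl L C I e D" "D \<subseteq> M" "small_model \<kappa> L C M" "is_aut L C f"
    "\<And>a. a \<in> M \<Longrightarrow> f a = a"
  shows "f \<in> Lascar_generators"
proof -
  have "hyp_in_dcl L C I e M" using assms(1,2) by (auto simp: hyp_in_dcl_def)
  then show ?thesis using assms unfolding Lascar_generators_def
    by (auto simp: hyp_in_dcl_def Aut_e_carrier)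
qed

lemma Lascar_generators_conj:
  assumes f: "f \<in> Lascar_generators" and g: "g \<in> carrier Aut_e"
  shows "g \<circ> f \<circ> inv_into UNIV g \<in> Lascar_generators"
proof -
  let ?g' = "inv_into UNIV g"
  obtain M where M: "small_model \<kappa> L C M" "hyp_in_dcl L C I e M" "\<forall>m\<in>M. f m = m"
    and f_in: "f \<in> carrier Aut_e"
    using f by (auto simp: Lascar_generators_def)
  have g': "?g' (g x) = x" for x using inv_comp_self[OF g] by (metis comp_apply id_apply)
  have aut: "g \<circ> f \<circ> ?g' \<in> carrier Aut_e" by (intro comp_closed inv_closed g f_in)
  have dcl: "hyp_in_dcl L C I e (g ` M)"
    unfolding hyp_in_dcl_def
  proof (intro allI impI)
    fix k assume k: "is_aut L C k \<and> (\<forall>a\<in>g ` M. k a = a)"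
    have "is_aut L C (?g' \<circ> k \<circ> g)"
      using k g by (intro is_aut_comp is_aut_inv) (auto simp: Aut_e_carrier)
    moreover have "\<forall>m\<in>M. (?g' \<circ> k \<circ> g) m = m" using k by (simp add: g')
    ultimately have "?g' \<circ> k \<circ> g \<in> carrier Aut_e"
      using M(2) by (simp add: hyp_in_dcl_def Aut_e_carrier)
    then have "g \<circ> (?g' \<circ> k \<circ> g) \<circ> ?g' \<in> carrier Aut_e"
      by (rule comp_closed[OF comp_closed[OF g] inv_closed[OF g]])
    also have "g \<circ> (?g' \<circ> k \<circ> g) \<circ> ?g' = k"
      using comp_inv_self[OF g] by (simp add: fun_eq_iff)
    finally show "fixes_hyp I e k" by (simp add: Aut_e_carrier)
  qed
  have "small_model \<kappa> L C (g ` M)" using small_model_aut M(1) g by (simp add: Aut_e_carrier)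
  moreover have "\<forall>m\<in>g ` M. (g \<circ> f \<circ> ?g') m = m" using M(3) by (simp add: g')
  ultimately show ?thesis using aut dcl by (auto simp: Lascar_generators_def)
qed

lemma Lascar_group_normal: "normal Lascar_group Aut_e"
  unfolding Lascar_group_eq
proof (rule group.normal_generateI[OF group_Aut_e])
  show "Lascar_generators \<subseteq> carrier Aut_e" by (auto simp: Lascar_generators_def)
  show "g \<otimes>\<^bsub>Aut_e\<^esub> f \<otimes>\<^bsub>Aut_e\<^esub> inv\<^bsub>Aut_e\<^esub> g \<in> Lascar_generators"
    if "f \<in> Lascar_generators" "g \<in> carrier Aut_e" for f g
    using Lascar_generators_conj[OF that] that(2) by (simp add: m_inv_Aut_e)
qed

lemma Lascar_subgroup: "subgroup Lascar_group Aut_e"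
  using Lascar_group_normal by (rule normal_imp_subgroup)

lemma Lascar_in_carrier: "g \<in> Lascar_group \<Longrightarrow> g \<in> carrier Aut_e"
  using subgroup.subset[OF Lascar_subgroup] by blast

lemma Gal_proj_comp:
  assumes f: "f \<in> carrier Aut_e" and g: "g \<in> Lascar_group"
  shows "Gal_proj \<kappa> L C I e (f \<circ> g) = Gal_proj \<kappa> L C I e f"
proof -
  interpret group Aut_e by (rule group_Aut_e)
  let ?n = "f \<circ> g \<circ> inv_into UNIV f"
  have "?n \<in> Lascar_group"
    using normal.inv_op_closed2[OF Lascar_group_normal f g] by (simp add: m_inv_Aut_e f)
  then have n: "?n \<in> carrier Aut_e" "Lascar_group #>\<^bsub>Aut_e\<^esub> ?n = Lascar_group"
    using coset_join2[OF Lascar_in_carrier Lascar_subgroup] Lascar_in_carrier by blast+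
  have "?n \<otimes>\<^bsub>Aut_e\<^esub> f = f \<circ> g \<circ> (inv_into UNIV f \<circ> f)" by (simp add: comp_assoc)
  also have "\<dots> = f \<circ> g" by (simp add: inv_comp_self[OF f])
  finally have "Lascar_group #>\<^bsub>Aut_e\<^esub> (f \<circ> g) = (Lascar_group #>\<^bsub>Aut_e\<^esub> ?n) #>\<^bsub>Aut_e\<^esub> f"
    using coset_mult_assoc[OF subgroup.subset[OF Lascar_subgroup] n(1) f] by simp
  then show ?thesis by (simp add: Gal_proj_def n(2))
qed

text \<open>As preimages under the projection to the Galois group, the KP and the Shelah group are unions
  of cosets of the Lascar group.\<close>

lemma Autf_comp_Lascar:
  assumes "f \<in> Autf \<kappa> L C I e M X" "g \<in> Lascar_group"
  shows "f \<circ> g \<in> Autf \<kappa> L C I e M X"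
proof (cases X)
  case Lascar
  then show ?thesis using assms subgroup.m_closed[OF Lascar_subgroup, of f g] by simp
qed (use assms Gal_proj_comp[of f g] comp_closed[of f g] Lascar_in_carrier[of g] in auto)

lemma Autf_in_carrier: "f \<in> Autf \<kappa> L C I e M X \<Longrightarrow> f \<in> carrier Aut_e"
  by (cases X) (auto intro: Lascar_in_carrier)

text \<open>Families of tuples are indexed by sets of pairs, while \<open>weaker_equiv\<close> refers to tuples indexed by
  ordinals.\<close>

lemma weaker_equiv_small_index:
  assumes "weaker_equiv \<kappa> H H'" "|W| <o \<kappa>" "orbit_equiv H' W c d"
  shows "orbit_equiv H W c d"
proof -
  obtain l g where g: "l \<in> Field \<kappa>" "bij_betw g (underS \<kappa> l) W"
    by (rule small_enumeration[OF assms(2)]) (rule that)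
  have W: "g ` underS \<kappa> l = W" using g(2) by (rule bij_betw_imp_surj_on)
  have eq: "orbit_equiv A (underS \<kappa> l) (c \<circ> g) (d \<circ> g) \<longleftrightarrow> orbit_equiv A W c d" for A
    unfolding orbit_equiv_def W[symmetric] by simp
  show ?thesis using assms(1,3) g(1) unfolding weaker_equiv_def eq[symmetric] by blast
qed

lemma aut_over_relatively_closed_orbit_equiv:
  fixes c :: "'i \<Rightarrow> 'j \<Rightarrow> 'm"
  assumes B: "relatively_closed L C J S B" and small: "|K| <o \<kappa>" "|J| <o \<kappa>" "|B| <o \<kappa>"
    and dcl: "hyp_in_dcl L C I e (coords J B)"
    and c: "c ` K \<subseteq> S" and f: "is_aut L C f" "\<And>a. a \<in> coords J B \<Longrightarrow> f a = a"
  shows "orbit_equiv Lascar_group (K \<times> J) (\<lambda>(k, j). c k j) (\<lambda>(k, j). f (c k j))"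
proof -
  obtain M1 f1 M2 f2 where
    1: "coords J B \<subseteq> M1" "small_model \<kappa> L C M1" "is_aut L C f1" "\<And>a. a \<in> M1 \<Longrightarrow> f1 a = a"
    and 2: "coords J B \<subseteq> M2" "small_model \<kappa> L C M2" "is_aut L C f2" "\<And>a. a \<in> M2 \<Longrightarrow> f2 a = a"
    and eq: "\<And>k j. k \<in> K \<Longrightarrow> j \<in> J \<Longrightarrow> f1 (c k j) = f2 (f (c k j))"
    by (rule aut_over_relatively_closed_Lascar[OF B small c f(1)]) (erule f(2), rule that)
  let ?f2' = "inv_into UNIV f2"
  have f2': "?f2' (f2 x) = x" for x using 2(3) by (simp add: is_aut_def bij_is_inj)
  have "f1 \<in> Lascar_generators" by (rule Lascar_generatorsI[OF dcl 1(1-3)]) (rule 1(4))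
  moreover have "?f2' \<in> Lascar_generators"
  proof (rule Lascar_generatorsI[OF dcl 2(1,2) is_aut_inv[OF 2(3)]])
    show "?f2' a = a" if "a \<in> M2" for a using f2'[of a] 2(4)[OF that] by simp
  qed
  ultimately have "?f2' \<circ> f1 \<in> Lascar_group"
    using generate.eng[OF generate.incl generate.incl, of ?f2' Lascar_generators f1 Aut_e]
    by (simp add: Lascar_group_eq)
  moreover have "(?f2' \<circ> f1) (c k j) = f (c k j)" if "k \<in> K" "j \<in> J" for k j
    using eq[OF that] f2' by simp
  ultimately show ?thesis unfolding orbit_equiv_def by (intro bexI[of _ "?f2' \<circ> f1"]) auto
qed

section \<open>Relativization\<close>

text \<open>The condition \<open>absorbs\<close> is what a subgroup \<open>H\<close> with \<open>\<equiv>\<^sup>H\<close> weaker than \<open>\<equiv>\<^sup>L\<close> and a union \<open>H\<close> of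
  cosets of the Lascar group have in common; it gives the inclusion from left to right.  For the
  converse, let \<open>f\<close> represent an element of the right-hand side and enumerate by \<open>b\<close> a small
  relatively closed set of realizations.  Some \<open>h \<in> H\<close> agrees with \<open>f\<close> on \<open>b\<close>, and the restriction
  of \<open>h\<^sup>-\<^sup>1 f\<close>, which fixes \<open>b\<close>, preserves Lascar strong types.\<close>

lemma restr_product_eq:
  fixes S :: "('k \<Rightarrow> 'm) set"
  assumes J: "|J| <o \<kappa>" and S: "S \<subseteq> tuples J UNIV"
    and invariant: "\<forall>f\<in>carrier Aut_e. \<forall>b\<in>S. compose J f b \<in> S"
    and B0: "|B0| <o \<kappa>" "B0 \<subseteq> S" "hyp_in_dcl L C I e (coords J B0)"
    and H: "H \<subseteq> carrier Aut_e"
    and absorbs: "\<And>h (W :: ('k \<times> 'k) set) c d. h \<in> H \<Longrightarrow> |W| <o \<kappa> \<Longrightarrow> orbit_equiv Lascar_group W c d \<Longrightarrow>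
      orbit_equiv H W c (h \<circ> d)"
  shows "restr J S ` H <#>\<^bsub>Aut_type L C I e J S\<^esub> Aut_type_equiv \<kappa> L C I e J S Lascar_group
    = Aut_type_equiv \<kappa> L C I e J S H"
proof -
  have restr: "restr J S f b j = f (b j)" if "b \<in> S" "j \<in> J" for f b j
    using that by (simp add: restr_def compose_def)
  have restr_comp: "compose S (restr J S f) (restr J S g) = restr J S (f \<circ> g)"
    if "g \<in> carrier Aut_e" for f g
  proof
    fix b show "compose S (restr J S f) (restr J S g) b = restr J S (f \<circ> g) b"
      using invariant that by (simp add: restr_def compose_comp compose_def[of S])
  qed
  have small_index: "|underS \<kappa> l \<times> J| <o \<kappa>" "|underS \<kappa> l| <o \<kappa>" if "l \<in> Field \<kappa>" for l
    using card_of_underS[OF Card that] small_Times J by auto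
  show ?thesis
  proof (intro equalityI subsetI)
    fix \<sigma> assume "\<sigma> \<in> restr J S ` H <#>\<^bsub>Aut_type L C I e J S\<^esub> Aut_type_equiv \<kappa> L C I e J S Lascar_group"
    then obtain h \<tau> where h: "h \<in> H" and \<tau>: "\<tau> \<in> Aut_type_equiv \<kappa> L C I e J S Lascar_group"
      and \<sigma>: "\<sigma> = compose S (restr J S h) \<tau>"
      by (auto simp: set_mult_def Aut_type_def)
    obtain g where g: "g \<in> carrier Aut_e" "\<tau> = restr J S g"
      using \<tau> by (auto simp: Aut_type_equiv_def Aut_type_def)
    have \<sigma>': "\<sigma> = restr J S (h \<circ> g)" using \<sigma> g restr_comp by simp
    have "h \<circ> g \<in> carrier Aut_e" using comp_closed g(1) h H by blast
    then have "\<sigma> \<in> carrier (Aut_type L C I e J S)" by (simp add: Aut_type_def \<sigma>')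
    moreover have "orbit_equiv H (underS \<kappa> l \<times> J) (\<lambda>(i, j). c i j) (\<lambda>(i, j). \<sigma> (c i) j)"
      if l: "l \<in> Field \<kappa>" and c: "c \<in> underS \<kappa> l \<rightarrow>\<^sub>E S" for l c
    proof -
      have "orbit_equiv Lascar_group (underS \<kappa> l \<times> J) (\<lambda>(i, j). c i j) (\<lambda>(i, j). \<tau> (c i) j)"
        using \<tau> l c by (simp add: Aut_type_equiv_def)
      from absorbs[OF h small_index(1)[OF l] this]
      have "orbit_equiv H (underS \<kappa> l \<times> J) (\<lambda>(i, j). c i j) (h \<circ> (\<lambda>(i, j). \<tau> (c i) j))" .
      then show ?thesis
        by (rule orbit_equiv_cong) (use PiE_mem[OF c] in \<open>auto simp: \<sigma>' g(2) restr\<close>)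
    qed
    ultimately show "\<sigma> \<in> Aut_type_equiv \<kappa> L C I e J S H" by (simp add: Aut_type_equiv_def)
  next
    fix \<sigma> assume \<sigma>: "\<sigma> \<in> Aut_type_equiv \<kappa> L C I e J S H"
    then obtain f where f: "f \<in> carrier Aut_e" "\<sigma> = restr J S f"
      by (auto simp: Aut_type_equiv_def Aut_type_def)
    obtain B where B: "B0 \<subseteq> B" "|B| <o \<kappa>" "relatively_closed L C J S B"
      by (rule exists_relatively_closed[OF J B0(1,2)]) (rule that)
    have BS: "B \<subseteq> S" using B(3) by (simp add: relatively_closed_def)
    have "coords J B0 \<subseteq> coords J B" using B(1) by (auto simp: coords_def)
    then have dcl: "hyp_in_dcl L C I e (coords J B)" using B0(3) by (auto simp: hyp_in_dcl_def)
    obtain l b where l: "l \<in> Field \<kappa>" and b: "bij_betw b (underS \<kappa> l) B"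
      by (rule small_enumeration[OF B(2)]) (rule that)
    let ?b = "restrict b (underS \<kappa> l)"
    have "?b \<in> underS \<kappa> l \<rightarrow>\<^sub>E S" using bij_betw_imp_surj_on[OF b] BS by auto
    moreover have "\<forall>l\<in>Field \<kappa>. \<forall>c\<in>underS \<kappa> l \<rightarrow>\<^sub>E S.
        orbit_equiv H (underS \<kappa> l \<times> J) (\<lambda>(i, j). c i j) (\<lambda>(i, j). \<sigma> (c i) j)"
      using \<sigma> by (simp add: Aut_type_equiv_def)
    ultimately have "orbit_equiv H (underS \<kappa> l \<times> J) (\<lambda>(i, j). ?b i j) (\<lambda>(i, j). \<sigma> (?b i) j)"
      using l by (blast dest: bspec)
    then obtain h where h: "h \<in> H" "\<And>i j. i \<in> underS \<kappa> l \<Longrightarrow> j \<in> J \<Longrightarrow> h (b i j) = \<sigma> (b i) j"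
      by (auto simp: orbit_equiv_def)
    have hC: "h \<in> carrier Aut_e" using h(1) H by blast
    let ?g = "inv_into UNIV h \<circ> f"
    have g: "?g \<in> carrier Aut_e" by (intro comp_closed inv_closed hC f)
    have g_fix: "?g a = a" if a: "a \<in> coords J B" for a
    proof -
      obtain i j where ij: "i \<in> underS \<kappa> l" "j \<in> J" "a = b i j"
        using a unfolding coords_def bij_betw_imp_surj_on[OF b, symmetric] by auto
      then have "b i \<in> S" using bij_betw_imp_surj_on[OF b] BS by blast
      then have "f a = h a" using h(2)[OF ij(1,2)] ij by (simp add: f(2) restr)
      then show ?thesis using inv_comp_self[OF hC] by (metis comp_apply id_apply)
    qed
    have "restr J S ?g \<in> Aut_type_equiv \<kappa> L C I e J S Lascar_group"
      unfolding Aut_type_equiv_def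
    proof (intro CollectI conjI ballI)
      show "restr J S ?g \<in> carrier (Aut_type L C I e J S)" using g by (simp add: Aut_type_def)
    next
      fix l c assume l: "l \<in> Field \<kappa>" and c: "c \<in> underS \<kappa> l \<rightarrow>\<^sub>E S"
      have cS: "c ` underS \<kappa> l \<subseteq> S" using c by auto
      have aut: "is_aut L C ?g" using g by (simp only: Aut_e_carrier)
      have "orbit_equiv Lascar_group (underS \<kappa> l \<times> J) (\<lambda>(i, j). c i j) (\<lambda>(i, j). ?g (c i j))"
        by (rule aut_over_relatively_closed_orbit_equiv
            [OF B(3) small_index(2)[OF l] J B(2) dcl cS aut]) (rule g_fix)
      then show "orbit_equiv Lascar_group (underS \<kappa> l \<times> J) (\<lambda>(i, j). c i j)
          (\<lambda>(i, j). restr J S ?g (c i) j)"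
        by (rule orbit_equiv_cong) (use PiE_mem[OF c] in \<open>auto simp: restr\<close>)
    qed
    moreover have "\<sigma> = compose S (restr J S h) (restr J S ?g)"
    proof -
      have "h \<circ> ?g = (h \<circ> inv_into UNIV h) \<circ> f" by (simp add: comp_assoc)
      then show ?thesis using restr_comp[OF g] comp_inv_self[OF hC] f(2) by simp
    qed
    ultimately show "\<sigma> \<in> restr J S ` H <#>\<^bsub>Aut_type L C I e J S\<^esub>
        Aut_type_equiv \<kappa> L C I e J S Lascar_group"
      using h(1) by (auto simp: set_mult_def Aut_type_def)
  qed
qed

end

theorem proposition3p5:
  fixes \<kappa> :: "'k rel"
    and L :: "('f, 'r) language"
    and T :: "('f, 'r, nat) fm set"
    and C :: "('f, 'r, 'm) struct"
    and \<alpha> \<beta> :: 'k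
    and I J :: "'k set"
    and e :: "('k \<Rightarrow> 'm) set"
    and \<Sigma> :: "('f, 'r, 'k + 'm) fm set"
    and S :: "('k \<Rightarrow> 'm) set"
  assumes "complete_theory L T" and "monster_model \<kappa> L T C"
    and "\<alpha> \<in> Field \<kappa>" and "I = underS \<kappa> \<alpha>" and "hyperimaginary L C I e"
    and "\<beta> \<in> Field \<kappa>" and "J = underS \<kappa> \<beta>" and "partial_type \<kappa> L C J \<Sigma>"
    and "S = solutions C J \<Sigma>" and "hyp_invariant L C I e J \<Sigma>"
    and "\<exists>l\<in>Field \<kappa>. \<exists>c0\<in>underS \<kappa> l \<rightarrow>\<^sub>E S.
           hyp_in_dcl L C I e {c0 i j | i j. i \<in> underS \<kappa> l \<and> j \<in> J}"
  shows "(\<forall>H. subgroup H (Aut_hyp L C I e) \<and> weaker_equiv \<kappa> H (Autf_L \<kappa> L C I e) \<longrightarrow>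
            restr J S ` H <#>\<^bsub>Aut_type L C I e J S\<^esub> Aut_type_equiv \<kappa> L C I e J S (Autf_L \<kappa> L C I e)
              = Aut_type_equiv \<kappa> L C I e J S H)
       \<and> (\<forall>M X. small_model \<kappa> L C M \<and> hyp_in_dcl L C I e M \<longrightarrow>
            restr J S ` Autf \<kappa> L C I e M X
                <#>\<^bsub>Aut_type L C I e J S\<^esub> Autf_type \<kappa> L C I e J S M Lascar
              = Autf_type \<kappa> L C I e J S M X)"
proof -
  interpret monster_hyperimaginary \<kappa> L T C I e
  proof
    show "monster_model \<kappa> L T C" by (rule assms)
    obtain E where "equiv (tuples I UNIV) E" "e \<in> tuples I UNIV // E"
      using assms(5) by (auto simp: hyperimaginary_def)
    then show "e \<subseteq> extensional I"
      using in_quotient_imp_subset[of "tuples I UNIV" E e] by (auto simp: PiE_def)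
  qed
  have J: "|J| <o \<kappa>" using card_of_underS[OF Card assms(6)] assms(7) by simp
  have S: "S \<subseteq> tuples J UNIV" using assms(9) by (auto simp: solutions_def)
  have invariant: "\<forall>f\<in>carrier Aut_e. \<forall>b\<in>S. compose J f b \<in> S"
    using assms(9,10) S by (auto simp: hyp_invariant_def)
  obtain l c0 where l: "l \<in> Field \<kappa>" and c0: "c0 \<in> underS \<kappa> l \<rightarrow>\<^sub>E S"
    and dcl: "hyp_in_dcl L C I e {c0 i j | i j. i \<in> underS \<kappa> l \<and> j \<in> J}"
    using assms(11) by blast
  let ?B0 = "c0 ` underS \<kappa> l"
  have B0: "|?B0| <o \<kappa>" "?B0 \<subseteq> S"
    using card_of_underS[OF Card l] c0 by (auto intro: small_image)
  have "coords J ?B0 = {c0 i j | i j. i \<in> underS \<kappa> l \<and> j \<in> J}"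
    by (force simp: coords_def)
  then have B0_dcl: "hyp_in_dcl L C I e (coords J ?B0)" using dcl by simp
  note product = restr_product_eq[OF J S invariant B0 B0_dcl]
  show ?thesis
  proof (intro conjI allI impI)
    fix H assume H: "subgroup H Aut_e \<and> weaker_equiv \<kappa> H Lascar_group"
    show "restr J S ` H <#>\<^bsub>Aut_type L C I e J S\<^esub> Aut_type_equiv \<kappa> L C I e J S Lascar_group
        = Aut_type_equiv \<kappa> L C I e J S H"
    proof (rule product)
      show "H \<subseteq> carrier Aut_e" using H subgroup.subset by blast
      fix h and W :: "('k \<times> 'k) set" and c d
      assume h: "h \<in> H" and W: "|W| <o \<kappa>" "orbit_equiv Lascar_group W c d"
      then obtain h' where h': "h' \<in> H" "\<forall>i\<in>W. h' (c i) = d i"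
        using weaker_equiv_small_index[of H Lascar_group W c d] H by (auto simp: orbit_equiv_def)
      have "h \<circ> h' \<in> H" using subgroup.m_closed[of H Aut_e h h'] H h h'(1) by simp
      then show "orbit_equiv H W c (h \<circ> d)" using h'(2) unfolding orbit_equiv_def
        by (intro bexI[of _ "h \<circ> h'"]) auto
    qed
  next
    fix M X
    show "restr J S ` Autf \<kappa> L C I e M X <#>\<^bsub>Aut_type L C I e J S\<^esub> Autf_type \<kappa> L C I e J S M Lascar
        = Autf_type \<kappa> L C I e J S M X"
      unfolding Autf_type_def Autf.simps(1)
    proof (rule product)
      show "Autf \<kappa> L C I e M X \<subseteq> carrier Aut_e" using Autf_in_carrier by blast
      fix h and W :: "('k \<times> 'k) set" and c d
      assume h: "h \<in> Autf \<kappa> L C I e M X" and "orbit_equiv Lascar_group W c d"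
      then obtain g where g: "g \<in> Lascar_group" "\<forall>i\<in>W. g (c i) = d i"
        by (auto simp: orbit_equiv_def)
      have "h \<circ> g \<in> Autf \<kappa> L C I e M X" using Autf_comp_Lascar[OF h g(1)] .
      then show "orbit_equiv (Autf \<kappa> L C I e M X) W c (h \<circ> d)"
        using g(2) unfolding orbit_equiv_def by (intro bexI[of _ "h \<circ> g"]) auto
    qed
  qed
qed

end
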